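(* Let $f(z)=z^D+c$ be a unicritical polynomial of degree $D\ge2$ with connected Julia set, and let $\Lambda$ be a hyperbolic set for $f$. Suppose moreover that either $0$ is accessible, or every $x\in\Lambda$ is combinatorially separated from $0$. Then there are only finitely many dynamic rays landing at each $x\in\Lambda$.
   Context: Hyperbolic set: a forward invariant compact set $\Lambda\subset\mathbb{C}$ such that there exist $\overline{k}\in\mathbb{N}$ and $\eta>1$ with $|(f^k)'(x)|>\eta$ for all $x\in\Lambda$ and all $k>\overline{k}$. Let $K(f)$ be the filled Julia set and let $B:\mathbb{C}\setminus K(f)\to\mathbb{C}\setminus\overline{\mathbb{D}}$ be the Böttcher map, i.e. the unique conformal isomorphism with $B\circ f=B^D$ and asymptotic to the identity at $\infty$. For $\mathbf{s}\in\mathbb{R}/\mathbb{Z}$ the dynamic ray of angle $\mathbf{s}$ is the curve $g_{\mathbf{s}}(t)=B^{-1}(e^te^{2\pi i\mathbf{s}})$, $t\in(0,\infty)$. A ray $g_{\mathbf{s}}$ lands at $z$ if $\overline{g_{\mathbf{s}}}\setminus g_{\mathbf{s}}=\{z\}$; a point is accessible if it is the landing point of at least one dynamic ray. Two points $z_1,z_2$ are combinatorially separated if there is a curve $\Gamma$ formed by two dynamic rays together with a common landing point such that $z_1,z_2$ belong to different components of $\mathbb{C}\setminus\Gamma$. *)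

theory Defs
  imports "HOL-Complex_Analysis.Complex_Analysis" "HOL-Library.Landau_Symbols"
begin

definition unicritical :: "nat \<Rightarrow> complex \<Rightarrow> complex \<Rightarrow> complex" where
  "unicritical D c = (\<lambda>z. z ^ D + c)"

definition filled_julia :: "(complex \<Rightarrow> complex) \<Rightarrow> complex set" where
  "filled_julia f = {z. bounded (range (\<lambda>n. (f ^^ n) z))}"

text \<open>The usual definition of the Julia set for polynomials of degree at least 2; it is not
  meant for other maps.\<close>

definition julia :: "(complex \<Rightarrow> complex) \<Rightarrow> complex set" where
  "julia f = frontier (filled_julia f)"

definition hyperbolic_set :: "(complex \<Rightarrow> complex) \<Rightarrow> complex set \<Rightarrow> bool" where
  "hyperbolic_set f \<Lambda> \<longleftrightarrow>
     compact \<Lambda> \<and> f ` \<Lambda> \<subseteq> \<Lambda> \<and>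
     (\<exists>kbar::nat. \<exists>\<eta>::real. \<eta> > 1 \<and> (\<forall>x\<in>\<Lambda>. \<forall>k>kbar. cmod (deriv (f ^^ k) x) > \<eta>))"

text \<open>The values of \<open>B\<close> on the filled Julia set are irrelevant. For connected filled Julia set,
  exactly one map on the complement has this property. The inverse of a holomorphic bijection
  between open sets is automatically holomorphic.\<close>

definition boettcher_map :: "(complex \<Rightarrow> complex) \<Rightarrow> nat \<Rightarrow> (complex \<Rightarrow> complex) \<Rightarrow> bool" where
  "boettcher_map f D B \<longleftrightarrow>
     B holomorphic_on (- filled_julia f) \<and>
     bij_betw B (- filled_julia f) (- cball 0 1) \<and>
     (\<forall>z\<in>- filled_julia f. B (f z) = B z ^ D) \<and>
     B \<sim>[at_infinity] (\<lambda>z. z)"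

text \<open>The angle in \<open>\<real>/\<int>\<close> is given by a real representative: the curve is 1-periodic in \<open>s\<close>.
  Only parameters \<open>t > 0\<close> are meaningful.\<close>

definition dynamic_ray ::
  "(complex \<Rightarrow> complex) \<Rightarrow> (complex \<Rightarrow> complex) \<Rightarrow> real \<Rightarrow> real \<Rightarrow> complex" where
  "dynamic_ray f B s t =
     inv_into (- filled_julia f) B (of_real (exp t) * exp (2 * of_real pi * \<i> * of_real s))"

text \<open>Rays are counted as point sets. Rays with angles that differ modulo 1 are disjoint, so
  this is the same as counting angles in \<open>\<real>/\<int>\<close>.\<close>

definition dynamic_rays ::
  "(complex \<Rightarrow> complex) \<Rightarrow> (complex \<Rightarrow> complex) \<Rightarrow> complex set set" where
  "dynamic_rays f B = range (\<lambda>s. dynamic_ray f B s ` {0<..})"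

definition lands_at :: "complex set \<Rightarrow> complex \<Rightarrow> bool" where
  "lands_at R z \<longleftrightarrow> closure R - R = {z}"

definition accessible ::
  "(complex \<Rightarrow> complex) \<Rightarrow> (complex \<Rightarrow> complex) \<Rightarrow> complex \<Rightarrow> bool" where
  "accessible f B z \<longleftrightarrow> (\<exists>R\<in>dynamic_rays f B. lands_at R z)"

definition combinatorially_separated ::
  "(complex \<Rightarrow> complex) \<Rightarrow> (complex \<Rightarrow> complex) \<Rightarrow> complex \<Rightarrow> complex \<Rightarrow> bool" where
  "combinatorially_separated f B z\<^sub>1 z\<^sub>2 \<longleftrightarrow>
     (\<exists>R\<^sub>1\<in>dynamic_rays f B. \<exists>R\<^sub>2\<in>dynamic_rays f B. \<exists>w.
        R\<^sub>1 \<noteq> R\<^sub>2 \<and> lands_at R\<^sub>1 w \<and> lands_at R\<^sub>2 w \<and>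
        (\<exists>C\<^sub>1\<in>components (- (R\<^sub>1 \<union> R\<^sub>2 \<union> {w})). \<exists>C\<^sub>2\<in>components (- (R\<^sub>1 \<union> R\<^sub>2 \<union> {w})).
           C\<^sub>1 \<noteq> C\<^sub>2 \<and> z\<^sub>1 \<in> C\<^sub>1 \<and> z\<^sub>2 \<in> C\<^sub>2))"

end

theory Submission imports Defs begin

text \<open>The angles of the rays landing at \<open>x \<noteq> 0\<close> are not linked with their rotations by the fractions
  \<open>j/D\<close>, since those rays land at other points. Hence multiplication by \<open>D\<close> preserves the cyclic order
  of these angles, and all but one of the complementary gaps are expanded by the factor \<open>D\<close>.

  The orbit of a point of \<open>\<Lambda>\<close> avoids the critical point \<open>0\<close>. If it is infinite, then three rays at
  the point would give a wandering triangle, which unlinkedness excludes. Otherwise it ends in a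
  repelling cycle, and one may assume \<open>x\<close> periodic. In small discs around \<open>x\<close>, a length estimate for
  rays shows that the backward orbit of a point of the basin of infinity visits some component of the
  basin twice. A path joining the two visits, repeated under the inverse branch, leads to \<open>x\<close> and by
  a normal families argument shows that a periodic ray lands at \<open>x\<close>. Then all rays landing at \<open>x\<close>
  have the same period, and there are finitely many of them.\<close>

section \<open>The Boettcher coordinate and dynamic rays\<close>

text \<open>The fractions \<open>j/D\<close> enter because the points with the same image as
  \<open>x\<close> are its rotations by the \<open>D\<close>-th roots of unity; these are
  \<open>D\<close> distinct points exactly when \<open>x\<close> is not \<open>0\<close>.
  Hyperbolicity keeps \<open>0\<close> out of the set, since all positive iterates have derivative
  zero there. Crossing of rays is detected by winding numbers of explicit loops, so the components
  of a plane complement need not be described. Combinatorics alone does not bound the number of rays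
  at a periodic point: an infinite set of angles on which the return map acts with irrational
  rotation number can satisfy the same unlinkedness conditions. An analytic argument has to supply
  one periodic angle. It compares two linear rates: the distance to the point and the potential both
  shrink geometrically under the inverse branch, so a ray outwards from the \<open>i\<close>-th
  preimage has on average a bounded logarithmic time for each of about \<open>i\<close> annuli.
  Hence many of its points are far from the filled Julia set relative to the annulus, and only
  boundedly many components of the basin have room for such points.\<close>

lemma eventually_at_infinity_norm:
  "eventually P at_infinity \<longleftrightarrow> (\<exists>b. \<forall>x::'a::real_normed_vector. norm x > b \<longrightarrow> P x)"
  unfolding eventually_at_infinity by (meson gt_ex less_le_trans less_imp_le)

locale boettcher_unicritical =
  fixes D :: nat and c :: complex and f B :: "complex \<Rightarrow> complex"
  assumes f_def: "f = unicritical D c"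
    and D_ge_2: "D \<ge> 2"
    and boettcher: "boettcher_map f D B"
begin

abbreviation K :: "complex set" where "K \<equiv> filled_julia f"

text \<open>The universal covering of the basin by the right half-plane: the real part is the
  potential, the imaginary part is \<open>2 * pi\<close> times the angle, and \<open>f\<close>
  becomes multiplication by \<open>D\<close>.\<close>

definition Psi :: "complex \<Rightarrow> complex" where
  "Psi Z = inv_into (- K) B (exp Z)"

text \<open>Convergence as the potential tends to \<open>0\<close>, with a real lift of the angle:
  the combinatorial part works with order and gaps of lifted angles.
  \<open>lands_at_imp_lands\<close> connects this with \<open>lands_at\<close>.\<close>

definition lands :: "real \<Rightarrow> complex \<Rightarrow> bool" where
  "lands s x \<longleftrightarrow> ((\<lambda>t. Psi (Complex t (2 * pi * s))) \<longlongrightarrow> x) (at_right 0)"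

section \<open>Escape radius and filled Julia set\<close>

lemma f_eq: "f z = z ^ D + c"
  by (simp add: f_def unicritical_def)

lemma D_pos: "D > 0" "real D \<ge> 2" "real D > 0"
  using D_ge_2 by auto

text \<open>The radius comes from \<open>norm z ^ 2 - norm c \<ge> (2 + norm c) * norm z - norm c *
  norm z\<close>, where \<open>norm z \<ge> 1\<close> is used in the last term.\<close>

lemma norm_f_ge:
  assumes "norm z \<ge> 2 + norm c"
  shows "norm (f z) \<ge> 2 * norm z"
proof -
  have z1: "norm z \<ge> 1" using assms norm_ge_zero[of c] by linarith
  have "norm z * norm z \<le> norm z ^ D"
    using power_increasing[OF D_ge_2 z1] by (simp add: power2_eq_square)
  moreover have "(2 + norm c) * norm z \<le> norm z * norm z"
    using assms by (intro mult_right_mono) auto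
  moreover have "norm c * 1 \<le> norm c * norm z"
    using z1 by (intro mult_left_mono) auto
  moreover have "norm (z ^ D + c) \<ge> norm z ^ D - norm c"
    by (metis norm_diff_ineq norm_power)
  ultimately show ?thesis by (simp add: f_eq algebra_simps)
qed

lemma norm_iter_ge:
  assumes "norm z \<ge> 2 + norm c"
  shows "norm ((f ^^ n) z) \<ge> 2 ^ n * norm z"
proof (induction n)
  case (Suc n)
  have "norm z \<le> 2 ^ n * norm z" by (simp add: mult_le_cancel_right1)
  then have "norm ((f ^^ n) z) \<ge> 2 + norm c" using Suc assms by linarith
  from norm_f_ge[OF this] Suc show ?case by simp
qed simp

lemma escape_notin_K:
  assumes "norm z \<ge> 2 + norm c"
  shows "z \<notin> K"
proof
  assume "z \<in> K"
  then obtain b where b: "\<And>n. norm ((f ^^ n) z) \<le> b"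
    by (auto simp: filled_julia_def bounded_iff)
  have z1: "norm z \<ge> 1" using assms norm_ge_zero[of c] by linarith
  obtain n where "2 ^ n > b" using real_arch_pow[of 2 b] by auto
  moreover have "(2::real) ^ n * 1 \<le> 2 ^ n * norm z" using z1 by (intro mult_left_mono) auto
  ultimately show False using norm_iter_ge[OF assms, of n] b[of n] by linarith
qed

lemma f_in_K_iff [simp]: "f z \<in> K \<longleftrightarrow> z \<in> K"
proof -
  have "range (\<lambda>n. (f ^^ n) z) = insert z (range (\<lambda>n. (f ^^ n) (f z)))"
  proof (intro set_eqI iffI)
    fix w assume "w \<in> range (\<lambda>n. (f ^^ n) z)"
    then obtain n where "w = (f ^^ n) z" by auto
    then show "w \<in> insert z (range (\<lambda>n. (f ^^ n) (f z)))"
      by (cases n) (auto simp: funpow_swap1)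
  next
    fix w assume "w \<in> insert z (range (\<lambda>n. (f ^^ n) (f z)))"
    then show "w \<in> range (\<lambda>n. (f ^^ n) z)"
    proof
      assume "w = z" then show ?thesis by (metis funpow_0 rangeI)
    next
      assume "w \<in> range (\<lambda>n. (f ^^ n) (f z))"
      then obtain n where "w = (f ^^ Suc n) z" by (auto simp: funpow_swap1)
      then show ?thesis by blast
    qed
  qed
  then show ?thesis by (simp add: filled_julia_def)
qed

lemma iter_in_K_iff [simp]: "(f ^^ n) z \<in> K \<longleftrightarrow> z \<in> K"
  by (induction n) auto

text \<open>Points outside the radius escape and \<open>K\<close> is forward invariant, so one bound
  serves all orbits. In this form \<open>K\<close> is an intersection of closed sets.\<close>

lemma K_eq: "K = {z. \<forall>n. norm ((f ^^ n) z) \<le> 2 + norm c}"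
proof (intro set_eqI iffI CollectI allI)
  fix z n assume "z \<in> K"
  then have "(f ^^ n) z \<in> K" by simp
  then show "norm ((f ^^ n) z) \<le> 2 + norm c" using escape_notin_K by (meson linear)
next
  fix z assume "z \<in> {z. \<forall>n. norm ((f ^^ n) z) \<le> 2 + norm c}"
  then show "z \<in> K" by (auto simp: filled_julia_def bounded_iff)
qed

lemma holomorphic_f: "f holomorphic_on S"
  unfolding f_def unicritical_def by (intro holomorphic_intros)

lemma continuous_f: "continuous_on S f"
  using holomorphic_f holomorphic_on_imp_continuous_on by blast

lemma holomorphic_iter: "(f ^^ n) holomorphic_on S"
proof (induction n arbitrary: S)
  case 0
  have "id holomorphic_on S" by (rule holomorphic_on_id)
  then show ?case by (simp add: id_def)
next
  case (Suc n)
  have "f \<circ> (f ^^ n) holomorphic_on S"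
    by (intro holomorphic_on_compose Suc holomorphic_f)
  then show ?case by (simp add: o_def)
qed

lemma continuous_iter: "continuous_on S (f ^^ n)"
  using holomorphic_iter holomorphic_on_imp_continuous_on by blast

lemma closed_K: "closed K"
proof -
  have "closed {z. norm ((f ^^ n) z) \<le> 2 + norm c}" for n
    by (intro closed_Collect_le continuous_on_norm continuous_iter continuous_on_const)
  then have "closed (\<Inter>n. {z. norm ((f ^^ n) z) \<le> 2 + norm c})" by auto
  moreover have "K = (\<Inter>n. {z. norm ((f ^^ n) z) \<le> 2 + norm c})" by (auto simp: K_eq)
  ultimately show ?thesis by simp
qed

lemma open_compl_K: "open (- K)"
  using closed_K by (simp add: open_Compl)

section \<open>Growth and symmetry of the Boettcher map\<close>

lemma holomorphic_B: "B holomorphic_on (- K)"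
  and bij_B: "bij_betw B (- K) (- cball 0 1)"
  and B_f: "z \<notin> K \<Longrightarrow> B (f z) = B z ^ D"
  and B_asymp: "B \<sim>[at_infinity] (\<lambda>z. z)"
  using boettcher by (auto simp: boettcher_map_def)

lemma norm_B: "z \<notin> K \<Longrightarrow> norm (B z) > 1"
  using bij_betwE[OF bij_B] by (metis ComplD ComplI mem_cball_0 not_le)

lemma inj_B: "inj_on B (- K)"
  using bij_B by (simp add: bij_betw_def)

lemma B_iter: "z \<notin> K \<Longrightarrow> B ((f ^^ n) z) = B z ^ (D ^ n)"
  by (induction n) (auto simp: B_f power_mult[symmetric] mult.commute)

lemma continuous_B: "continuous_on (- K) B"
  using holomorphic_B holomorphic_on_imp_continuous_on by blast

lemma Bi_B: "z \<notin> K \<Longrightarrow> inv_into (- K) B (B z) = z"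
  using inj_B by (simp add: inv_into_f_f)

lemma B_Bi: "norm w > 1 \<Longrightarrow> B (inv_into (- K) B w) = w"
  using bij_B by (intro f_inv_into_f) (auto simp: bij_betw_def)

lemma Bi_notin_K: "norm w > 1 \<Longrightarrow> inv_into (- K) B w \<notin> K"
  using bij_B inv_into_into[of w B "- K"] by (auto simp: bij_betw_def)

lemma holomorphic_Bi: "inv_into (- K) B holomorphic_on (- cball 0 1)"
proof -
  obtain g where g: "g holomorphic_on (B ` (- K))" "\<And>z. z \<in> - K \<Longrightarrow> deriv B z * deriv g (B z) = 1"
      "\<And>z. z \<in> - K \<Longrightarrow> g (B z) = z"
    using holomorphic_has_inverse[OF holomorphic_B open_compl_K inj_B] by blast
  have im: "B ` (- K) = - cball 0 1" using bij_B by (simp add: bij_betw_def)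
  have "inv_into (- K) B w = g w" if "w \<in> - cball 0 1" for w
  proof -
    have "w \<in> B ` (- K)" using that im by simp
    then obtain z where z: "z \<in> - K" "w = B z" by (rule imageE)
    have "inv_into (- K) B (B z) = z" by (rule inv_into_f_f[OF inj_B z(1)])
    then show ?thesis unfolding z(2) g(3)[OF z(1)] .
  qed
  then show ?thesis using g(1) im holomorphic_cong by metis
qed

lemma connected_compl_K: "connected (- K)"
proof -
  have "connected (- cball (0::complex) 1)"
    by (intro connected_complement_bounded_convex) auto
  then have "connected (inv_into (- K) B ` (- cball 0 1))"
    using holomorphic_Bi holomorphic_on_imp_continuous_on connected_continuous_image by blast
  moreover have "inv_into (- K) B ` (- cball 0 1) = - K"
    using bij_betw_inv_into[OF bij_B] by (simp add: bij_betw_def)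
  ultimately show ?thesis by simp
qed

lemma B_div_tendsto: "((\<lambda>z. B z / z) \<longlongrightarrow> 1) at_infinity"
proof -
  have "eventually (\<lambda>z::complex. z \<noteq> 0) at_infinity"
    by (auto simp: eventually_at_infinity intro!: exI[of _ 1])
  then show ?thesis
    by (intro asymp_equivD_strong[OF B_asymp]) (auto elim: eventually_mono)
qed

lemma norm_bounded_if_B_bounded:
  obtains C where "\<And>z. z \<notin> K \<Longrightarrow> norm (B z) \<le> T \<Longrightarrow> norm z \<le> C"
proof -
  have "eventually (\<lambda>z. norm (B z / z - 1) < 1/2) at_infinity"
    using B_div_tendsto unfolding tendsto_iff dist_norm by (meson half_gt_zero zero_less_one)
  then obtain b where b: "\<And>z. norm z > b \<Longrightarrow> norm (B z / z - 1) < 1/2"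
    by (auto simp: eventually_at_infinity_norm)
  have "norm z \<le> max (max b 0) (2 * T)" if "norm (B z) \<le> T" for z
  proof (rule ccontr)
    assume *: "\<not> ?thesis"
    then have z: "norm z > b" "norm z > 0" "norm z > 2 * T" by auto
    have "norm (B z / z) > 1/2"
      using b[OF z(1)] norm_triangle_ineq[of "1 - B z / z" "B z / z"]
      by (simp add: norm_minus_commute)
    then have "norm (B z) > norm z / 2" using z(2) by (simp add: norm_divide field_simps)
    then show False using z that by simp
  qed
  then show ?thesis using that by blast
qed

lemma B_bounded_if_norm_bounded:
  obtains C where "\<And>z. z \<notin> K \<Longrightarrow> norm z \<le> T \<Longrightarrow> norm (B z) \<le> C"
proof -
  define R where "R = max T (2 + norm c)"
  define R' where "R' = R ^ D + norm c"
  define S where "S = {z::complex. R \<le> norm z \<and> norm z \<le> R'}"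
  have "S = cball 0 R' \<inter> - ball 0 R" by (auto simp: S_def)
  then have "compact S" by (simp add: compact_Int_closed closed_Compl)
  moreover have SK: "S \<subseteq> - K" using escape_notin_K by (auto simp: S_def R_def)
  ultimately have "compact (B ` S)"
    using continuous_B compact_continuous_image continuous_on_subset by blast
  then obtain C where C: "\<And>z. z \<in> S \<Longrightarrow> norm (B z) \<le> C"
    using compact_imp_bounded[of "B ` S"] by (auto simp: bounded_iff)
  have "norm (B z) \<le> C" if z: "z \<notin> K" "norm z \<le> T" for z
  proof -
    have zR: "norm z \<le> R" using z by (simp add: R_def)
    obtain n where n: "norm ((f ^^ n) z) > R"
    proof (rule ccontr)
      assume "\<not> thesis"
      then have "\<forall>n. norm ((f ^^ n) z) \<le> R" using that by (meson not_le)
      then have "z \<in> K" by (auto simp: filled_julia_def bounded_iff)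
      then show False using z by simp
    qed
    define m where "m = (LEAST n. norm ((f ^^ n) z) > R)"
    have m: "norm ((f ^^ m) z) > R" unfolding m_def by (rule LeastI) (rule n)
    have "m \<noteq> 0" using m zR by (intro notI) simp
    then obtain k where k: "m = Suc k" using not0_implies_Suc by blast
    have "norm ((f ^^ k) z) \<le> R"
      using not_less_Least[of k "\<lambda>n. norm ((f ^^ n) z) > R"] k by (auto simp: m_def[symmetric])
    then have "norm ((f ^^ k) z) ^ D \<le> R ^ D" by (intro power_mono) auto
    then have "norm ((f ^^ m) z) \<le> R'"
      unfolding R'_def k using norm_triangle_ineq[of "((f ^^ k) z) ^ D" c]
      by (simp add: f_eq norm_power)
    then have "norm (B ((f ^^ m) z)) \<le> C" using m by (intro C) (auto simp: S_def)
    then have "norm (B z) ^ (D ^ m) \<le> C" using z by (simp add: B_iter norm_power)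
    moreover have "norm (B z) \<le> norm (B z) ^ (D ^ m)"
      using norm_B[OF z(1)] D_pos by (intro self_le_power) auto
    ultimately show ?thesis by simp
  qed
  then show ?thesis using that by blast
qed

lemma filterlim_Bi: "filterlim (inv_into (- K) B) at_infinity at_infinity"
proof (subst filterlim_at_infinity[where c = 0], simp, intro allI impI)
  fix r :: real assume "r > 0"
  obtain C where C: "\<And>z. z \<notin> K \<Longrightarrow> norm z \<le> r \<Longrightarrow> norm (B z) \<le> C"
    using B_bounded_if_norm_bounded by blast
  have "norm (inv_into (- K) B w) \<ge> r" if "norm w > max 1 C" for w
  proof (rule ccontr)
    assume "\<not> ?thesis"
    then have "norm (B (inv_into (- K) B w)) \<le> C" using that by (intro C Bi_notin_K) auto
    then show False using that by (simp add: B_Bi)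
  qed
  then show "eventually (\<lambda>x. r \<le> norm (inv_into (- K) B x)) at_infinity"
    unfolding eventually_at_infinity_norm by blast
qed

lemma Bi_div_tendsto: "((\<lambda>w. inv_into (- K) B w / w) \<longlongrightarrow> 1) at_infinity"
proof -
  have "((\<lambda>w. inverse (B (inv_into (- K) B w) / inv_into (- K) B w)) \<longlongrightarrow> inverse 1) at_infinity"
    by (intro tendsto_inverse filterlim_compose[OF B_div_tendsto filterlim_Bi]) auto
  moreover have "eventually (\<lambda>w. inverse (B (inv_into (- K) B w) / inv_into (- K) B w)
      = inv_into (- K) B w / w) at_infinity"
    unfolding eventually_at_infinity_norm by (intro exI[of _ 1]) (auto simp: B_Bi)
  ultimately have "((\<lambda>w. inv_into (- K) B w / w) \<longlongrightarrow> inverse 1) at_infinity"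
    by (rule Lim_transform_eventually)
  then show ?thesis by simp
qed

text \<open>Since \<open>f (w * z) = f z\<close>, the quotient \<open>B (w * z) / B z\<close> is a
  \<open>D\<close>-th root of unity, hence constant on the connected basin; its limit at infinity is
  \<open>w\<close>.\<close>

lemma B_rotate:
  assumes w: "w ^ D = 1" and z: "z \<notin> K"
  shows "w * z \<notin> K" "B (w * z) = w * B z"
proof -
  have w0: "w \<noteq> 0" using w D_pos by (metis power_0_left zero_neq_one not_gr_zero)
  have nw: "norm w = 1"
    using w D_pos by (metis norm_power norm_one power_eq_1_iff norm_ge_zero not_gr_zero abs_norm_cancel)
  have fw: "f (w * z) = f z" for z by (simp add: f_eq power_mult_distrib w)
  have wK: "w * z \<notin> K" if "z \<notin> K" for z using f_in_K_iff fw that by metis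
  show "w * z \<notin> K" by (rule wK[OF z])
  define q where "q z = B (w * z) / B z" for z
  have B0: "B z \<noteq> 0" if "z \<notin> K" for z using norm_B[OF that] by auto
  have cont: "continuous_on (- K) q"
    unfolding q_def
    by (intro continuous_intros continuous_on_compose2[OF continuous_B])
       (use wK B0 in auto)
  have q_root: "q z \<in> {u. u ^ D = 1}" if "z \<in> - K" for z
  proof -
    have "B (w * z) ^ D = B z ^ D" using that wK B_f fw by (metis ComplD)
    then show ?thesis using B0 that by (simp add: q_def power_divide)
  qed
  have fin: "finite {u::complex. u ^ D = 1}"
    using finite_nth_roots D_pos by blast
  have "q constant_on (- K)"
    using q_root by (intro continuous_finite_range_constant[OF connected_compl_K cont] finite_subset[OF _ fin]) blast
  then obtain a where a: "\<And>z. z \<in> - K \<Longrightarrow> q z = a" by (auto simp: constant_on_def)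
  have lim: "((\<lambda>z. w * (B (w * z) / (w * z)) / (B z / z)) \<longlongrightarrow> w * 1 / 1) at_infinity"
  proof (intro tendsto_intros B_div_tendsto filterlim_compose[OF B_div_tendsto])
    show "filterlim ((*) w) at_infinity at_infinity"
      by (intro tendsto_mult_filterlim_at_infinity[of _ w] tendsto_const filterlim_ident w0)
  qed auto
  have "eventually (\<lambda>z. w * (B (w * z) / (w * z)) / (B z / z) = a) at_infinity"
    unfolding eventually_at_infinity_norm
  proof (intro exI[of _ "2 + norm c"] allI impI)
    fix z :: complex assume *: "norm z > 2 + norm c"
    then have "z \<notin> K" using escape_notin_K by simp
    moreover have "z \<noteq> 0" using * norm_ge_zero[of c] by (intro notI) simp
    ultimately show "w * (B (w * z) / (w * z)) / (B z / z) = a"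
      using a[of z] w0 by (simp add: q_def field_simps)
  qed
  then have "((\<lambda>_::complex. a) \<longlongrightarrow> w) at_infinity"
    using lim by (simp add: filterlim_cong[OF refl refl])
  then have "a = w" using tendsto_unique[OF trivial_limit_at_infinity] tendsto_const by blast
  then show "B (w * z) = w * B z" using a[of z] z B0[OF z] by (simp add: q_def field_simps)
qed

section \<open>The half-plane coordinate and landing of rays\<close>

lemma Psi_notin_K: "Re Z > 0 \<Longrightarrow> Psi Z \<notin> K"
  unfolding Psi_def by (intro Bi_notin_K) auto

lemma B_Psi: "Re Z > 0 \<Longrightarrow> B (Psi Z) = exp Z"
  unfolding Psi_def by (intro B_Bi) auto

lemma Psi_eq_iff:
  assumes "Re Z > 0" "Re Z' > 0"
  shows "Psi Z = Psi Z' \<longleftrightarrow> exp Z = exp Z'"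
  by (metis B_Psi[OF assms(1)] B_Psi[OF assms(2)] Psi_def)

lemma holomorphic_Psi: "Psi holomorphic_on {Z. Re Z > 0}"
proof -
  have "inv_into (- K) B \<circ> exp holomorphic_on {Z. Re Z > 0}"
    by (intro holomorphic_on_compose_gen[OF _ holomorphic_Bi] holomorphic_intros) auto
  then show ?thesis by (simp add: Psi_def[abs_def] o_def)
qed

lemma open_right_half: "open {Z. Re Z > 0}"
  using open_halfspace_Re_gt[of 0] by simp

lemma continuous_Psi: "continuous_on {Z. Re Z > 0} Psi"
  using holomorphic_Psi holomorphic_on_imp_continuous_on by blast

lemma Psi_surj:
  assumes "z \<notin> K"
  obtains Z where "Re Z > 0" "Psi Z = z"
proof -
  have n: "norm (B z) > 1" by (rule norm_B[OF assms])
  then have "exp (Ln (B z)) = B z" by (intro exp_Ln) auto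
  moreover have "Re (Ln (B z)) > 0" using n by (subst Re_Ln) (auto intro: ln_gt_zero)
  ultimately show ?thesis using that[of "Ln (B z)"] assms Bi_B by (simp add: Psi_def)
qed

lemma f_Psi:
  assumes "Re Z > 0"
  shows "f (Psi Z) = Psi (of_nat D * Z)"
proof -
  have "B (f (Psi Z)) = exp (of_nat D * Z)"
    using assms by (simp add: B_f Psi_notin_K B_Psi exp_of_nat_mult)
  moreover have "f (Psi Z) \<notin> K" using Psi_notin_K[OF assms] by simp
  ultimately show ?thesis unfolding Psi_def by (metis Bi_B)
qed

lemma iter_Psi:
  assumes "Re Z > 0"
  shows "(f ^^ n) (Psi Z) = Psi (of_nat (D ^ n) * Z)"
proof (induction n)
  case (Suc n)
  have "Re (of_nat (D ^ n) * Z) > 0"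
    using assms D_pos by (simp del: of_nat_power)
  then show ?case using Suc f_Psi by (simp add: mult.assoc)
qed simp

lemma cis_root: "cis (2 * pi * of_int j / D) ^ D = 1"
proof -
  have "cis (2 * pi * of_int j / D) ^ D = cis (real D * (2 * pi * of_int j / D))" by (rule Complex.DeMoivre)
  also have "real D * (2 * pi * of_int j / D) = 2 * pi * of_int j" using D_pos by simp
  also have "cis (2 * pi * of_int j) = 1" by (rule cis_multiple_2pi) simp
  finally show ?thesis .
qed

lemma rotate_Psi:
  assumes "Re Z > 0"
  shows "cis (2 * pi * of_int j / D) * Psi Z = Psi (Z + Complex 0 (2 * pi * of_int j / D))"
proof -
  note r = B_rotate[OF cis_root Psi_notin_K[OF assms]]
  have "B (cis (2 * pi * of_int j / D) * Psi Z) = exp (Z + Complex 0 (2 * pi * of_int j / D))"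
    unfolding r(2) B_Psi[OF assms] exp_add
    by (simp only: cis_conv_exp Complex_eq of_real_0 add_0_left mult.commute)
  then show ?thesis unfolding Psi_def by (metis Bi_B r(1) Psi_def)
qed

text \<open>\<open>norm (B (Psi (Z n)))\<close> is \<open>exp (Re (Z n))\<close> and tends to
  \<open>1\<close>, whereas \<open>B\<close> is continuous with \<open>norm (B z) > 1\<close> off
  \<open>K\<close>.\<close>

lemma limit_in_K:
  assumes "\<And>n. Re (Z n) > 0" "(\<lambda>n. Re (Z n)) \<longlonglongrightarrow> 0" "(\<lambda>n. Psi (Z n)) \<longlonglongrightarrow> z"
  shows "z \<in> K"
proof (rule ccontr)
  assume z: "z \<notin> K"
  have "isCont B z"
    using continuous_B open_compl_K z by (simp add: continuous_on_eq_continuous_at)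
  then have "(\<lambda>n. norm (B (Psi (Z n)))) \<longlonglongrightarrow> norm (B z)"
    using isCont_tendsto_compose[OF _ assms(3)] by (intro tendsto_norm) blast
  moreover have "(\<lambda>n. norm (B (Psi (Z n)))) = (\<lambda>n. exp (Re (Z n)))"
    using assms(1) by (simp add: B_Psi)
  moreover have "(\<lambda>n. exp (Re (Z n))) \<longlonglongrightarrow> exp 0"
    by (intro tendsto_intros assms(2))
  ultimately have "norm (B z) = 1" using LIMSEQ_unique by fastforce
  then show False using norm_B[OF z] by simp
qed

lemma lands_seq:
  assumes "lands s x" "\<And>n. T n > 0" "T \<longlonglongrightarrow> 0"
  shows "(\<lambda>n. Psi (Complex (T n) (2 * pi * s))) \<longlonglongrightarrow> x"
proof -
  have "filterlim T (at_right 0) sequentially"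
    using assms(2,3) by (simp add: filterlim_at less_imp_neq[THEN not_sym])
  then show ?thesis using assms(1) unfolding lands_def by (rule filterlim_compose[rotated])
qed

lemma lands_in_K:
  assumes "lands s x" shows "x \<in> K"
proof (rule limit_in_K)
  show "(\<lambda>n. Psi (Complex (inverse (real (Suc n))) (2 * pi * s))) \<longlonglongrightarrow> x"
    by (rule lands_seq[OF assms _ LIMSEQ_inverse_real_of_nat]) simp
  show "(\<lambda>n. Re (Complex (inverse (real (Suc n))) (2 * pi * s))) \<longlonglongrightarrow> 0"
    using LIMSEQ_inverse_real_of_nat by simp
qed simp

lemma lands_unique: "lands s x \<Longrightarrow> lands s y \<Longrightarrow> x = y"
  unfolding lands_def by (rule tendsto_unique[rotated]) auto

lemma Psi_add_2pi_int: "Psi (Complex t (2 * pi * (s + of_int j))) = Psi (Complex t (2 * pi * s))"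
proof -
  have "exp (Complex t (2 * pi * (s + of_int j))) = exp (Complex t (2 * pi * s))"
    unfolding exp_eq by (intro exI[of _ j]) (simp add: complex_eq_iff algebra_simps)
  then show ?thesis by (simp add: Psi_def)
qed

lemma lands_add_int: "lands (s + of_int j) x \<longleftrightarrow> lands s x"
  by (simp add: lands_def Psi_add_2pi_int)

lemma lands_f:
  assumes "lands s x" shows "lands (real D * s) (f x)"
proof -
  have "isCont f x" using continuous_f[of UNIV] by (simp add: continuous_on_eq_continuous_at)
  then have 1: "((\<lambda>t. f (Psi (Complex t (2 * pi * s)))) \<longlongrightarrow> f x) (at_right 0)"
    using assms unfolding lands_def by (rule isCont_tendsto_compose)
  have 2: "filterlim (\<lambda>t. t / real D) (at_right 0) (at_right 0)"
    unfolding filterlim_at using D_pos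
    by (auto intro!: tendsto_eq_intros simp: eventually_at_right_field intro: exI[of _ 1])
  have "((\<lambda>t. f (Psi (Complex (t / real D) (2 * pi * s)))) \<longlongrightarrow> f x) (at_right 0)"
    by (rule filterlim_compose[OF 1 2])
  moreover have "eventually (\<lambda>t. f (Psi (Complex (t / real D) (2 * pi * s)))
      = Psi (Complex t (2 * pi * (real D * s)))) (at_right 0)"
    unfolding eventually_at_right_field
  proof (intro exI[of _ 1] conjI allI impI)
    fix t :: real assume "0 < t" "t < 1"
    moreover have "of_nat D * Complex (t / real D) (2 * pi * s) = Complex t (2 * pi * (real D * s))"
      using D_pos by (simp add: complex_eq_iff)
    ultimately show "f (Psi (Complex (t / real D) (2 * pi * s)))
      = Psi (Complex t (2 * pi * (real D * s)))" using D_pos by (subst f_Psi) auto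
  qed simp
  ultimately show ?thesis unfolding lands_def by (rule Lim_transform_eventually)
qed

lemma lands_rotate:
  assumes "lands s x" shows "lands (s + of_int j / real D) (cis (2 * pi * of_int j / D) * x)"
proof -
  have "((\<lambda>t. cis (2 * pi * of_int j / D) * Psi (Complex t (2 * pi * s)))
      \<longlongrightarrow> cis (2 * pi * of_int j / D) * x) (at_right 0)"
    using assms unfolding lands_def by (intro tendsto_intros)
  moreover have "eventually (\<lambda>t. cis (2 * pi * of_int j / D) * Psi (Complex t (2 * pi * s))
      = Psi (Complex t (2 * pi * (s + of_int j / real D)))) (at_right 0)"
    unfolding eventually_at_right_field
  proof (intro exI[of _ 1] conjI allI impI)
    fix t :: real assume "0 < t" "t < 1"
    moreover have "Complex t (2 * pi * s) + Complex 0 (2 * pi * of_int j / D)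
        = Complex t (2 * pi * (s + of_int j / real D))"
      by (simp add: complex_eq_iff algebra_simps)
    ultimately show "cis (2 * pi * of_int j / D) * Psi (Complex t (2 * pi * s))
      = Psi (Complex t (2 * pi * (s + of_int j / real D)))" by (subst rotate_Psi) auto
  qed simp
  ultimately show ?thesis unfolding lands_def by (rule Lim_transform_eventually)
qed

lemma dynamic_ray_eq: "dynamic_ray f B s t = Psi (Complex t (2 * pi * s))"
proof -
  have "of_real (exp t) * exp (2 * of_real pi * \<i> * of_real s) = exp (Complex t (2 * pi * s))"
    by (simp add: exp_of_real[symmetric] exp_add[symmetric] Complex_eq algebra_simps)
  then show ?thesis by (simp add: dynamic_ray_def Psi_def)
qed

text \<open>Suppose the ray stays away from \<open>x\<close> along potentials tending to
  \<open>0\<close>. These points are bounded, and a subsequential limit lies in \<open>K\<close>,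
  hence in the closure of the ray but not on it; the only such point is \<open>x\<close>.\<close>

lemma lands_at_imp_lands:
  assumes "lands_at (dynamic_ray f B s ` {0<..}) x"
  shows "lands s x"
proof (rule ccontr)
  define R where "R = dynamic_ray f B s ` {0<..}"
  define g where "g t = Psi (Complex t (2 * pi * s))" for t
  have clos: "closure R - R = {x}" using assms by (simp add: lands_at_def R_def)
  have g_R: "g t \<in> R" if "t > 0" for t
    using that by (auto simp: g_def R_def dynamic_ray_eq)
  have R_K: "R \<inter> K = {}"
    using Psi_notin_K by (auto simp: R_def dynamic_ray_eq)
  assume "\<not> lands s x"
  then obtain e where e: "e > 0" "\<not> eventually (\<lambda>t. dist (g t) x < e) (at_right 0)"
    by (auto simp: lands_def tendsto_iff g_def)
  have "\<exists>t>0. t < inverse (real (Suc n)) \<and> dist (g t) x \<ge> e" for n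
  proof (rule ccontr)
    assume "\<not> ?thesis"
    then have "\<forall>t>0. t < inverse (real (Suc n)) \<longrightarrow> dist (g t) x < e" by (auto simp: not_le)
    then show False
      using e(2) inverse_positive_iff_positive[of "real (Suc n)"]
      unfolding eventually_at_right_field by (metis of_nat_0_less_iff zero_less_Suc)
  qed
  then obtain T where T: "\<And>n. T n > 0" "\<And>n. T n < inverse (real (Suc n))"
      "\<And>n. dist (g (T n)) x \<ge> e" by metis
  have T0: "T \<longlonglongrightarrow> 0"
  proof (rule real_tendsto_sandwich[OF _ _ tendsto_const LIMSEQ_inverse_real_of_nat])
    show "eventually (\<lambda>n. 0 \<le> T n) sequentially" using T(1) by (simp add: less_imp_le)
    show "eventually (\<lambda>n. T n \<le> inverse (real (Suc n))) sequentially"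
      using T(2) by (simp add: less_imp_le del: of_nat_Suc)
  qed
  obtain C where C: "\<And>z. z \<notin> K \<Longrightarrow> norm (B z) \<le> exp 1 \<Longrightarrow> norm z \<le> C"
    using norm_bounded_if_B_bounded by blast
  have "norm (g (T n)) \<le> C" for n
  proof (rule C)
    show "g (T n) \<notin> K" using g_R T(1) R_K by blast
    have "inverse (real (Suc n)) \<le> 1" by (simp add: field_simps)
    then have "T n \<le> 1" using T(2)[of n] by linarith
    then show "norm (B (g (T n))) \<le> exp 1"
      using T(1) by (simp add: g_def B_Psi)
  qed
  then have "bounded (range (\<lambda>n. g (T n)))" by (auto simp: bounded_iff)
  then obtain z r where r: "strict_mono r" "((\<lambda>n. g (T n)) \<circ> r) \<longlonglongrightarrow> z"
    using bounded_imp_convergent_subsequence by blast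
  have "z \<in> K"
  proof (rule limit_in_K)
    show "(\<lambda>n. Psi (Complex (T (r n)) (2 * pi * s))) \<longlonglongrightarrow> z"
      using r(2) by (simp add: g_def o_def)
    show "(\<lambda>n. Re (Complex (T (r n)) (2 * pi * s))) \<longlonglongrightarrow> 0"
      using LIMSEQ_subseq_LIMSEQ[OF T0 r(1)] by (simp add: o_def)
  qed (use T in auto)
  moreover have "z \<in> closure R"
    unfolding closure_sequential using r(2) g_R T(1)
    by (intro exI[of _ "(\<lambda>n. g (T n)) \<circ> r"]) auto
  ultimately have "z \<in> closure R - R" using R_K by blast
  then have "z = x" unfolding clos by simp
  then have "(\<lambda>n. dist (g (T (r n))) x) \<longlonglongrightarrow> 0"
    using r(2) unfolding tendsto_dist_iff[of _ z] o_def by simp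
  then have "e \<le> 0" by (rule LIMSEQ_le_const) (use T(3) in blast)
  then show False using e by simp
qed

end

section \<open>Rays with different landing points are unlinked\<close>

context boettcher_unicritical
begin

lemma continuous_on_Psi_Complex:
  assumes "continuous_on S g" "continuous_on S h" "\<And>x. x \<in> S \<Longrightarrow> g x > 0"
  shows "continuous_on S (\<lambda>x. Psi (Complex (g x) (h x)))"
  by (rule continuous_on_compose2[OF continuous_Psi continuous_on_Complex[OF assms(1,2)]])
     (use assms(3) in auto)

lemma Psi_Complex_eq_iff:
  assumes "t > 0" "t' > 0"
  shows "Psi (Complex t (2 * pi * s)) = Psi (Complex t' (2 * pi * s')) \<longleftrightarrow>
    t = t' \<and> (\<exists>j::int. s = s' + of_int j)"
proof -
  have "Complex t (2 * pi * s) = Complex t' (2 * pi * s') + of_real (of_int (2 * j) * pi) * \<i>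
      \<longleftrightarrow> t = t' \<and> s = s' + of_int j" for j
  proof -
    have "2 * pi * s = 2 * pi * s' + 2 * of_int j * pi \<longleftrightarrow> 2 * pi * s = 2 * pi * (s' + of_int j)"
      by (simp add: algebra_simps)
    then show ?thesis by (simp add: complex_eq_iff)
  qed
  then show ?thesis
    using assms by (subst Psi_eq_iff) (simp_all only: exp_eq complex.sel ex_simps)
qed

text \<open>The parameter is the potential, so that the path on \<open>{0..1}\<close> ends on the
  equipotential used in the loops below.\<close>

definition ray_path :: "real \<Rightarrow> complex \<Rightarrow> real \<Rightarrow> complex" where
  "ray_path s x = (\<lambda>u. if u = 0 then x else Psi (Complex u (2 * pi * s)))"

lemma path_ray_path:
  assumes "lands s x"
  shows "path (ray_path s x)"
proof -
  have "continuous (at u within {0..1}) (ray_path s x)" if u: "u \<in> {0..1}" for u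
  proof (cases "u = 0")
    case True
    have "eventually (\<lambda>t. Psi (Complex t (2 * pi * s)) = ray_path s x t) (at_right 0)"
      unfolding eventually_at_right_field ray_path_def by (intro exI[of _ 1]) auto
    then have "(ray_path s x \<longlongrightarrow> x) (at_right 0)"
      using assms unfolding lands_def by (rule Lim_transform_eventually[rotated])
    then show ?thesis
      unfolding True continuous_within at_within_Icc_at_right[OF zero_less_one]
      by (simp add: ray_path_def)
  next
    case False
    then have u0: "u \<in> {0<..}" using u by simp
    have "continuous_on {0<..} (\<lambda>t. Psi (Complex t (2 * pi * s)))"
      by (intro continuous_on_Psi_Complex continuous_intros) auto
    then have "continuous_on {0<..} (ray_path s x)"
      by (rule continuous_on_eq) (auto simp: ray_path_def)
    then have "isCont (ray_path s x) u"
      using u0 open_greaterThan continuous_on_eq_continuous_at by blast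
    then show ?thesis by (rule continuous_at_imp_continuous_at_within)
  qed
  then show ?thesis by (simp add: path_def continuous_on_eq_continuous_within)
qed

text \<open>Raising the potential and rotating the initial angle back to \<open>0\<close> is a
  homotopy of loops that never meets the lower potential of \<open>Z\<close>. At large potential the
  inverse of \<open>B\<close> is close to the identity, and the loop can be compared with a
  circle.\<close>

lemma winding_number_equipotential:
  assumes z: "0 < Re Z" "Re Z < 1"
  shows "winding_number (\<lambda>u. Psi (Complex 1 (2 * pi * (a + u)))) (Psi Z) = 1"
proof -
  define z where "z = Psi Z"
  have "eventually (\<lambda>w. dist (inv_into (- K) B w / w) 1 < 1 / 2) at_infinity"
    using Bi_div_tendsto by (rule tendstoD) simp
  then obtain r where r: "\<And>w. norm w > r \<Longrightarrow> dist (inv_into (- K) B w / w) 1 < 1 / 2"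
    unfolding eventually_at_infinity_norm by blast
  \<comment> \<open>Beyond \<open>r\<close> the loop is within half the radius of the circle; beyond
    \<open>2 * norm z\<close> the circle stays further than that from \<open>z\<close>.\<close>
  define R where "R = max r (max 1 (2 * norm z)) + 1"
  define T where "T = max 1 (ln R)"
  have R: "R > r" "R > 1" "R > 2 * norm z" by (auto simp: R_def)
  have T: "T \<ge> 1" "exp T \<ge> R"
  proof -
    have "R = exp (ln R)" using R by simp
    also have "\<dots> \<le> exp T" by (simp add: T_def)
    finally show "exp T \<ge> R" .
  qed (simp add: T_def)
  define h where "h = (\<lambda>y::real \<times> real. Psi (Complex (1 + fst y * (T - 1)) (2 * pi * ((1 - fst y) * a + snd y))))"
  define g where "g = (\<lambda>u. Psi (Complex T (2 * pi * u)))"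
  have pos: "1 + s * (T - 1) \<ge> 1" if "s \<in> {0..1}" for s using that T by simp
  have "homotopic_loops (- {z}) (\<lambda>u. Psi (Complex 1 (2 * pi * (a + u)))) g"
    unfolding homotopic_loops
  proof (intro exI[of _ h] conjI ballI)
    show "continuous_on ({0..1} \<times> {0..1}) h" unfolding h_def
    proof (intro continuous_on_Psi_Complex continuous_intros)
      fix y :: "real \<times> real" assume "y \<in> {0..1} \<times> {0..1}"
      then show "0 < 1 + fst y * (T - 1)" using pos[of "fst y"] by fastforce
    qed
    show "h \<in> {0..1} \<times> {0..1} \<rightarrow> - {z}"
    proof
      fix y :: "real \<times> real" assume "y \<in> {0..1} \<times> {0..1}"
      then have p: "1 + fst y * (T - 1) \<ge> 1" using pos[of "fst y"] by fastforce
      have "h y \<noteq> z"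
      proof
        assume "h y = z"
        then have "B (Psi (Complex (1 + fst y * (T - 1)) (2 * pi * ((1 - fst y) * a + snd y)))) = B (Psi Z)"
          by (simp add: h_def z_def)
        then have "norm (exp (Complex (1 + fst y * (T - 1)) (2 * pi * ((1 - fst y) * a + snd y)))) = norm (exp Z)"
          using p z by (simp add: B_Psi)
        then show False using p z by simp
      qed
      then show "h y \<in> - {z}" by simp
    qed
  next
    fix t :: real assume t: "t \<in> {0..1}"
    have "h (t, 1) = Psi (Complex (1 + t * (T - 1)) (2 * pi * (((1 - t) * a + 0) + of_int 1)))"
      by (simp add: h_def algebra_simps)
    also have "\<dots> = h (t, 0)" unfolding Psi_add_2pi_int by (simp add: h_def)
    finally show "pathfinish (h \<circ> Pair t) = pathstart (h \<circ> Pair t)"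
      by (simp add: pathfinish_def pathstart_def)
  qed (auto simp: h_def g_def)
  then have 1: "winding_number (\<lambda>u. Psi (Complex 1 (2 * pi * (a + u)))) z = winding_number g z"
    by (rule winding_number_homotopic_loops)
  have g_eq: "g u = inv_into (- K) B (circlepath 0 (exp T) u)" for u
  proof -
    have "exp (Complex T (2 * pi * u)) = circlepath 0 (exp T) u"
      by (simp add: circlepath Complex_eq exp_add exp_of_real algebra_simps)
    then show ?thesis by (simp add: g_def Psi_def)
  qed
  have norm_c: "norm (circlepath 0 (exp T) u) = exp T" for u
    by (simp add: circlepath norm_mult)
  have near: "norm (g u - circlepath 0 (exp T) u) < norm (circlepath 0 (exp T) u - z)" for u
  proof -
    define w where "w = circlepath 0 (exp T) u"
    have w: "norm w = exp T" "w \<noteq> 0" using norm_c[of u] by (auto simp: w_def)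
    have "norm (inv_into (- K) B w / w - 1) < 1 / 2" using r[of w] w T R by (simp add: dist_norm)
    then have "norm (inv_into (- K) B w / w - 1) * norm w < norm w / 2" using w by simp
    moreover have "norm (inv_into (- K) B w / w - 1) * norm w = norm (g u - w)"
    proof -
      have "norm (g u - w) = norm ((inv_into (- K) B w / w - 1) * w)"
        using w(2) by (simp add: left_diff_distrib g_eq w_def)
      then show ?thesis by (simp add: norm_mult)
    qed
    moreover have "norm w - norm z \<le> norm (w - z)" by (rule norm_triangle_ineq2)
    ultimately show ?thesis using w T R unfolding w_def[symmetric] by linarith
  qed
  have "winding_number g z = winding_number (circlepath 0 (exp T)) z"
  proof (rule winding_number_homotopic_loops[symmetric], rule homotopic_loops_nearby_explicit)
    show "path g" unfolding path_def g_def
      by (intro continuous_on_Psi_Complex continuous_intros) (use T in auto)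
    have "g 1 = g 0" unfolding g_eq by (simp add: circlepath)
    then show "pathfinish g = pathstart g" by (simp add: pathfinish_def pathstart_def)
    show "\<And>t x. t \<in> {0..1} \<Longrightarrow> x \<notin> - {z} \<Longrightarrow>
      norm (g t - circlepath 0 (exp T) t) < norm (circlepath 0 (exp T) t - x)"
      using near by simp
  qed (simp_all add: path_circlepath)
  also have "\<dots> = 1"
  proof (rule winding_number_circlepath)
    show "norm (z - 0) < exp T" using T R norm_ge_zero[of z] by simp
  qed
  finally show ?thesis using 1 by (simp add: z_def)
qed

text \<open>Each landing point together with two of its rays and an arc of an equipotential forms a loop.
  The two loops obtained from complementary arcs have winding numbers that differ by one below
  the equipotential, but a ray that leaves through the other arc sees winding number zero.\<close>

lemma rays_unlinked:
  assumes lands: "lands a x" "lands b x" "lands s y" "lands s' y" and "x \<noteq> y"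
    and less: "a < s" "s < b" "b < s'" "s' < a + 1"
  shows False
proof -
  define g where "g = (\<lambda>u. Psi (Complex 1 (2 * pi * (a + u))))"
  define v where "v = b - a"
  have v: "0 < v" "v < 1" using less by (auto simp: v_def)
  define A1 where "A1 = subpath 0 v g"
  define A2 where "A2 = subpath v 1 g"
  define P where "P = ray_path a x"
  define Q where "Q = ray_path b x"
  have path_g: "path g" unfolding path_def g_def
    by (intro continuous_on_Psi_Complex continuous_intros) auto
  have paths: "path A1" "path A2" "path P" "path Q"
    unfolding A1_def A2_def P_def Q_def using path_g v lands
    by (auto intro!: path_subpath path_ray_path)
  have PQ: "pathstart P = x" "pathstart Q = x" "pathfinish P = Psi (Complex 1 (2 * pi * a))"
    "pathfinish Q = Psi (Complex 1 (2 * pi * b))"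
    by (auto simp: P_def Q_def pathstart_def pathfinish_def ray_path_def)
  have g1: "g 1 = Psi (Complex 1 (2 * pi * a))"
    using Psi_add_2pi_int[of 1 a 1] by (simp add: g_def)
  have AA: "pathstart A1 = Psi (Complex 1 (2 * pi * a))" "pathfinish A1 = Psi (Complex 1 (2 * pi * b))"
    "pathstart A2 = Psi (Complex 1 (2 * pi * b))" "pathfinish A2 = Psi (Complex 1 (2 * pi * a))"
    using g1 by (simp_all add: A1_def A2_def) (simp_all add: g_def v_def)
  \<comment> \<open>\<open>G1\<close> uses the arc from \<open>a\<close> to \<open>b\<close>,
    \<open>G2\<close> the complementary arc run backwards; formally \<open>G1 - G2\<close> is the
    whole equipotential \<open>g\<close>.\<close>
  define G1 where "G1 = P +++ (A1 +++ reversepath Q)"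
  define G2 where "G2 = P +++ (reversepath A2 +++ reversepath Q)"
  have G: "path G1" "path G2" "pathfinish G1 = pathstart G1" "pathfinish G2 = pathstart G2"
    using paths PQ AA by (auto simp: G1_def G2_def)
  have wn: "winding_number G1 z - winding_number G2 z = winding_number g z"
    if "z \<notin> path_image P" "z \<notin> path_image Q" "z \<notin> path_image g" for z
  proof -
    have A: "z \<notin> path_image A1" "z \<notin> path_image A2"
      using that(3) v path_image_subpath_subset[of 0 v g] path_image_subpath_subset[of v 1 g]
      unfolding A1_def A2_def by auto
    have "winding_number G1 z = winding_number P z + (winding_number A1 z - winding_number Q z)"
      using that A paths PQ AA by (simp add: G1_def winding_number_join winding_number_reversepath path_image_join)
    moreover have "winding_number G2 z = winding_number P z + (- winding_number A2 z - winding_number Q z)"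
      using that A paths PQ AA by (simp add: G2_def winding_number_join winding_number_reversepath path_image_join)
    moreover have "winding_number A1 z + winding_number A2 z = winding_number (subpath 0 1 g) z"
      unfolding A1_def A2_def using v by (intro winding_number_subpath_combine path_g that(3)) auto
    ultimately show ?thesis by simp
  qed
  have xyK: "x \<in> K" "y \<in> K" using lands lands_in_K by blast+
  have img_P: "path_image P \<subseteq> insert x ((\<lambda>t. Psi (Complex t (2 * pi * a))) ` {0<..})"
    by (auto simp: P_def ray_path_def path_image_def)
  have img_Q: "path_image Q \<subseteq> insert x ((\<lambda>t. Psi (Complex t (2 * pi * b))) ` {0<..})"
    by (auto simp: Q_def ray_path_def path_image_def)
  have img_A1: "path_image A1 \<subseteq> (\<lambda>r. Psi (Complex 1 (2 * pi * r))) ` {a..b}"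
  proof -
    have "path_image A1 = g ` {0..v}" using v by (simp add: A1_def path_image_subpath)
    also have "\<dots> = (\<lambda>r. Psi (Complex 1 (2 * pi * r))) ` ((+) a ` {0..v})"
      unfolding g_def image_image ..
    finally show ?thesis by (auto simp: v_def algebra_simps)
  qed
  have img_A2: "path_image A2 \<subseteq> (\<lambda>r. Psi (Complex 1 (2 * pi * r))) ` {b..a + 1}"
  proof -
    have "path_image A2 = g ` {v..1}" using v by (simp add: A2_def path_image_subpath)
    also have "\<dots> = (\<lambda>r. Psi (Complex 1 (2 * pi * r))) ` ((+) a ` {v..1})"
      unfolding g_def image_image ..
    finally show ?thesis by (auto simp: v_def algebra_simps)
  qed
  have img_G1: "path_image G1 = path_image P \<union> (path_image A1 \<union> path_image Q)"
    using PQ AA by (simp add: G1_def path_image_join)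
  have img_G2: "path_image G2 = path_image P \<union> (path_image A2 \<union> path_image Q)"
    using PQ AA by (simp add: G2_def path_image_join)
  have not_P: "Psi (Complex t (2 * pi * r)) \<notin> path_image P \<and> Psi (Complex t (2 * pi * r)) \<notin> path_image Q"
    if "t > 0" "a < r" "r < a + 1" "r \<noteq> b" for t r
  proof -
    have "r \<noteq> a + of_int j" for j :: int
    proof
      assume "r = a + of_int j"
      then have "0 < real_of_int j" "real_of_int j < 1" using that by auto
      then show False by simp
    qed
    moreover have "r \<noteq> b + of_int j" for j :: int
    proof
      assume *: "r = b + of_int j"
      then have "-1 < real_of_int j" "real_of_int j < 1" using that less by linarith+
      then have "j = 0" by linarith
      then show False using * that by simp
    qed
    moreover have "Psi (Complex t (2 * pi * r)) \<noteq> x" using Psi_notin_K[of "Complex t (2 * pi * r)"] that xyK by auto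
    ultimately show ?thesis using img_P img_Q that(1) by (auto simp: Psi_Complex_eq_iff dest!: subsetD)
  qed
  have not_A1: "Psi (Complex t (2 * pi * s')) \<notin> path_image A1" if "t > 0" for t
  proof
    assume "Psi (Complex t (2 * pi * s')) \<in> path_image A1"
    then have "Psi (Complex t (2 * pi * s')) \<in> (\<lambda>r. Psi (Complex 1 (2 * pi * r))) ` {a..b}"
      by (rule subsetD[OF img_A1])
    then obtain r where "r \<in> {a..b}" and r3: "Psi (Complex t (2 * pi * s')) = Psi (Complex 1 (2 * pi * r))"
      by (rule imageE) blast
    then have r: "a \<le> r" "r \<le> b" by auto
    have "\<exists>j::int. s' = r + of_int j" using that r3 by (simp add: Psi_Complex_eq_iff)
    then obtain j :: int where j: "s' = r + of_int j" by blast
    then have "0 < real_of_int j" "real_of_int j < 1" using r less by linarith+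
    then show False by simp
  qed
  have not_A2: "Psi (Complex t (2 * pi * s)) \<notin> path_image A2" if "t > 0" for t
  proof
    assume "Psi (Complex t (2 * pi * s)) \<in> path_image A2"
    then have "Psi (Complex t (2 * pi * s)) \<in> (\<lambda>r. Psi (Complex 1 (2 * pi * r))) ` {b..a + 1}"
      by (rule subsetD[OF img_A2])
    then obtain r where "r \<in> {b..a + 1}" and r3: "Psi (Complex t (2 * pi * s)) = Psi (Complex 1 (2 * pi * r))"
      by (rule imageE) blast
    then have r: "b \<le> r" "r \<le> a + 1" by auto
    have "\<exists>j::int. s = r + of_int j" using that r3 by (simp add: Psi_Complex_eq_iff)
    then obtain j :: int where j: "s = r + of_int j" by blast
    then have "-1 < real_of_int j" "real_of_int j < 0" using r less by linarith+
    then show False by simp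
  qed
  have zero: "winding_number H (Psi (Complex (1 / 2) (2 * pi * r))) = 0"
    if H: "path H" "pathfinish H = pathstart H" "\<And>t. t > 0 \<Longrightarrow> Psi (Complex t (2 * pi * r)) \<notin> path_image H" for H r
  proof -
    define S where "S = (\<lambda>t. Psi (Complex t (2 * pi * r))) ` {0<..}"
    have "connected S" unfolding S_def
      by (intro connected_continuous_image continuous_on_Psi_Complex continuous_intros) auto
    moreover have "S \<inter> path_image H = {}" using H(3) by (auto simp: S_def)
    ultimately have "winding_number H constant_on S" by (intro winding_number_constant H)
    then obtain k where k: "\<And>z. z \<in> S \<Longrightarrow> winding_number H z = k" by (auto simp: constant_on_def)
    obtain R where R: "\<And>z. R \<le> norm z \<Longrightarrow> winding_number H z = 0"
      using winding_number_zero_at_infinity[OF H(1,2)] by blast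
    obtain C where C: "\<And>z. z \<notin> K \<Longrightarrow> norm z \<le> R \<Longrightarrow> norm (B z) \<le> C"
      using B_bounded_if_norm_bounded by blast
    define t where "t = \<bar>C\<bar> + 1"
    have t: "t > 0" by (simp add: t_def)
    have "\<not> norm (Psi (Complex t (2 * pi * r))) \<le> R"
    proof
      assume "norm (Psi (Complex t (2 * pi * r))) \<le> R"
      then have "norm (B (Psi (Complex t (2 * pi * r)))) \<le> C" using t by (intro C Psi_notin_K) auto
      then have "exp t \<le> C" using t by (simp add: B_Psi)
      moreover have "exp t \<ge> 1 + t" by (rule exp_ge_add_one_self)
      ultimately show False by (simp add: t_def)
    qed
    then have "winding_number H (Psi (Complex t (2 * pi * r))) = 0" using R by simp
    then have "k = 0" using k[of "Psi (Complex t (2 * pi * r))"] t by (simp add: S_def)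
    then show ?thesis using k[of "Psi (Complex (1 / 2) (2 * pi * r))"] by (simp add: S_def)
  qed
  have s: "a < s" "s < a + 1" "s \<noteq> b" and s': "a < s'" "s' < a + 1" "s' \<noteq> b" using less by auto
  define z z' where "z = Psi (Complex (1 / 2) (2 * pi * s))" and "z' = Psi (Complex (1 / 2) (2 * pi * s'))"
  have z2: "winding_number G2 z = 0"
    unfolding z_def using not_P[OF _ s] not_A2 by (intro zero G) (auto simp: img_G2)
  have z1: "winding_number G1 z' = 0"
    unfolding z'_def using not_P[OF _ s'] not_A1 by (intro zero G) (auto simp: img_G1)
  \<comment> \<open>At potential at most \<open>1 / 2\<close>, the two rays joined at
    \<open>y\<close> meet neither the arc nor the rays at \<open>x\<close>. Hence \<open>G1\<close>
    winds equally often around \<open>z\<close> and \<open>z'\<close>, namely zero times; so does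
    \<open>G2\<close> around \<open>z\<close>, against the difference one.\<close>
  define S where "S = ray_path s y ` {0..1 / 2} \<union> ray_path s' y ` {0..1 / 2}"
  have conn: "connected S" unfolding S_def
  proof (rule connected_Un)
    have "continuous_on {0..1 / 2} (ray_path s y)" "continuous_on {0..1 / 2} (ray_path s' y)"
      using path_ray_path[OF lands(3)] path_ray_path[OF lands(4)] unfolding path_def
      by (auto intro: continuous_on_subset)
    then show "connected (ray_path s y ` {0..1 / 2})" "connected (ray_path s' y ` {0..1 / 2})"
      by (auto intro: connected_continuous_image)
    have "y \<in> ray_path s y ` {0..1 / 2}" "y \<in> ray_path s' y ` {0..1 / 2}"
      by (auto simp: ray_path_def image_iff)
    then show "ray_path s y ` {0..1 / 2} \<inter> ray_path s' y ` {0..1 / 2} \<noteq> {}" by blast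
  qed
  have S_cases: "w = y \<or> (\<exists>t r. 0 < t \<and> t \<le> 1 / 2 \<and> r \<in> {s, s'} \<and> w = Psi (Complex t (2 * pi * r)))"
    if w: "w \<in> S" for w
  proof -
    obtain u r where u: "u \<in> {0..1 / 2}" "r \<in> {s, s'}" "w = ray_path r y u"
      using w unfolding S_def by blast
    show ?thesis
    proof (cases "u = 0")
      case True then show ?thesis using u by (simp add: ray_path_def)
    next
      case False
      then have "0 < u" "u \<le> 1 / 2" "w = Psi (Complex u (2 * pi * r))"
        using u by (auto simp: ray_path_def)
      then show ?thesis using u(2) by blast
    qed
  qed
  have low: "Psi (Complex t (2 * pi * r)) \<noteq> Psi (Complex 1 (2 * pi * r'))" if "0 < t" "t \<le> 1 / 2" for t r r'
    using that by (simp add: Psi_Complex_eq_iff)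
  have "w \<notin> path_image G1" if "w \<in> S" for w
    using S_cases[OF that]
  proof (elim disjE exE conjE)
    assume w: "w = y"
    have ne: "y \<noteq> Psi (Complex t r)" if "t > 0" for t r
      using Psi_notin_K[of "Complex t r"] that xyK by auto
    have "y \<notin> (\<lambda>t. Psi (Complex t (2 * pi * r))) ` {0<..}" for r
      using ne by auto
    moreover have "y \<notin> (\<lambda>r. Psi (Complex 1 (2 * pi * r))) ` X" for X
      using ne[OF zero_less_one] by blast
    ultimately have "y \<notin> path_image P" "y \<notin> path_image Q" "y \<notin> path_image A1"
      using \<open>x \<noteq> y\<close> img_P img_Q img_A1 by blast+
    then show ?thesis unfolding w img_G1 by simp
  next
    fix t r assume w: "0 < t" "t \<le> 1 / 2" "r \<in> {s, s'}" "w = Psi (Complex t (2 * pi * r))"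
    then have "w \<notin> path_image P \<and> w \<notin> path_image Q" using not_P s s' by blast
    moreover have "w \<notin> path_image A1" using low[OF w(1,2)] img_A1 unfolding w(4) by blast
    ultimately show ?thesis by (simp add: img_G1)
  qed
  then have "winding_number G1 constant_on S" by (intro winding_number_constant G conn) auto
  moreover have "z \<in> S" "z' \<in> S" unfolding S_def z_def z'_def
    by (auto simp: ray_path_def image_iff intro!: bexI[of _ "1 / 2"])
  ultimately have "winding_number G1 z = winding_number G1 z'" by (auto simp: constant_on_def)
  moreover have "winding_number G1 z - winding_number G2 z = winding_number g z"
  proof (rule wn)
    show "z \<notin> path_image P" "z \<notin> path_image Q" using not_P[OF _ s] by (auto simp: z_def)
    show "z \<notin> path_image g" using low unfolding z_def g_def path_image_def by auto
  qed
  moreover have "winding_number g z = 1"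
    unfolding g_def z_def by (rule winding_number_equipotential) auto
  ultimately show False using z1 z2 by simp
qed

end

section \<open>Combinatorics of unlinked angles\<close>

text \<open>Abstracts the lifted angles at a single point distinct from \<open>0\<close>. Multiples
  of \<open>D\<close> are excluded for \<open>j\<close> because they rotate the point to
  itself.\<close>

locale rotation_unlinked =
  fixes D :: nat and A :: "real set"
  assumes D_ge_2: "D \<ge> 2"
    and add_int: "s \<in> A \<Longrightarrow> s + of_int j \<in> A"
    and rotation_disjoint: "\<not> int D dvd j \<Longrightarrow> a \<in> A \<Longrightarrow> b \<in> A \<Longrightarrow> a \<noteq> b + of_int j / D"
    and rotation_unlinked: "\<not> int D dvd j \<Longrightarrow> a \<in> A \<Longrightarrow> b \<in> A \<Longrightarrow> c \<in> A \<Longrightarrow> d \<in> A \<Longrightarrow>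
      \<not> (a < c + of_int j / D \<and> c + of_int j / D < b \<and> b < d + of_int j / D \<and> d + of_int j / D < a + 1)"
begin

lemma inverse_D: "1 / real D \<le> 1 / 2" "1 / real D > 0" "real D \<ge> 2" "real D * (1 / real D) = 1"
  using D_ge_2 by (auto simp: field_simps)

lemma not_dvd_1: "\<not> int D dvd 1" "\<not> int D dvd - 1"
  using D_ge_2 by auto

text \<open>Otherwise \<open>a < a + 1/D < b < b + 1/D < a + 1\<close>, with equalities excluded by
  disjointness: the pair is linked with its own rotation.\<close>

lemma pair_gap:
  assumes "a \<in> A" "b \<in> A" "a < b" "b < a + 1"
  shows "b - a < 1 / D \<or> b - a > 1 - 1 / D"
proof (rule ccontr)
  assume *: "\<not> ?thesis"
  have "b \<noteq> a + of_int 1 / D" "a + of_int 1 \<noteq> b + of_int 1 / D"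
    using rotation_disjoint[OF not_dvd_1(1)] assms add_int by blast+
  moreover have "\<not> (a < a + of_int 1 / D \<and> a + of_int 1 / D < b \<and> b < b + of_int 1 / D
      \<and> b + of_int 1 / D < a + 1)"
    by (rule rotation_unlinked[OF not_dvd_1(1)]) (use assms in auto)
  ultimately show False using * inverse_D by auto
qed

text \<open>If the three angles fit in no arc shorter than \<open>1/D\<close>, then
  \<open>pair_gap\<close> makes all three cyclic gaps shorter than \<open>1/D\<close>. They add up
  to \<open>1\<close>, which forces \<open>D = 2\<close>; there the half turn of the pair
  \<open>a, b\<close> is linked with the pair \<open>b, c\<close>.\<close>

lemma triple_gap:
  assumes "a \<in> A" "b \<in> A" "c \<in> A" "a < b" "b < c" "c < a + 1"
  shows "c - a < 1 / D \<or> a + 1 - b < 1 / D \<or> b + 1 - c < 1 / D"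
proof (rule ccontr)
  assume *: "\<not> ?thesis"
  have a1: "a + 1 \<in> A" using add_int[OF assms(1), of 1] by simp
  have gaps: "b - a < 1 / D" "c - b < 1 / D" "a + 1 - c < 1 / D"
    using pair_gap[of a b] pair_gap[of b c] pair_gap[of c "a + 1"] assms a1 * by auto
  have "3 / real D > 1" using gaps by simp
  then have "real D < 3" using inverse_D by (simp add: field_simps)
  then have "D = 2" using D_ge_2 by linarith
  moreover have "\<not> (b < a + of_int 1 / D \<and> a + of_int 1 / D < c \<and> c < b + of_int 1 / D
      \<and> b + of_int 1 / D < b + 1)"
    by (rule rotation_unlinked[OF not_dvd_1(1)]) (use assms in auto)
  ultimately show False using gaps by simp
qed

end

text \<open>The first return map of the angles at a periodic point preserves their cyclic order, and
  multiplication expands, so one periodic angle forces all angles to have the same period.\<close>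

lemma angles_periodic:
  fixes A :: "nat \<Rightarrow> real set" and D q :: nat and s :: real
  assumes unl: "\<And>n. rotation_unlinked D (A n)"
    and mult: "\<And>n a. a \<in> A n \<Longrightarrow> real D * a \<in> A (Suc n)"
    and period: "A q = A 0" and s: "s \<in> A 0" "real D ^ q * s = s + of_int j"
    and b: "b \<in> A 0" "s < b" "b < s + 1"
  shows "(real D ^ q - 1) * (b - s) \<in> \<int>"
proof -
  \<comment> \<open>Positions of the angles relative to the orbit of \<open>s\<close>;
    \<open>phi\<close> is multiplication by \<open>D\<close> on positions, reduced modulo
    \<open>1\<close>. By \<open>pair_gap\<close> a position is below \<open>1/D\<close> or above
    \<open>1 - 1/D\<close>, so the integer to subtract is \<open>0\<close> or
    \<open>D - 1\<close>.\<close>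
  define W where "W n = {w::real. 0 < w \<and> w < 1 \<and> real D ^ n * s + w \<in> A n}" for n
  define phi :: "real \<Rightarrow> real" where "phi = (\<lambda>w. if w < 1 / D then real D * w else real D * w - (real D - 1))" for w
  have D: "real D \<ge> 2" "D \<ge> 2" using rotation_unlinked.inverse_D[OF unl] rotation_unlinked.D_ge_2[OF unl] by auto
  have s_in: "real D ^ n * s \<in> A n" for n
    by (induction n) (use s mult in \<open>auto simp: mult.assoc\<close>)
  have sub_int: "w \<in> A n \<Longrightarrow> w - of_int i \<in> A n" for w n i
    using rotation_unlinked.add_int[OF unl, of w n "- i"] by simp
  have phi_W: "phi w \<in> W (Suc n)" if w: "w \<in> W n" for w :: real and n
  proof -
    have 1: "w < 1 / D \<or> w > 1 - 1 / D"
      using rotation_unlinked.pair_gap[OF unl[of n] s_in[of n], of "real D ^ n * s + w"] w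
      by (simp add: W_def)
    have 2: "real D * (real D ^ n * s + w) \<in> A (Suc n)" using w mult by (simp add: W_def)
    show ?thesis
    proof (cases "w < 1 / D")
      case True
      then show ?thesis using 2 w D by (simp add: W_def phi_def field_simps)
    next
      case False
      then have "w > 1 - 1 / D" using 1 by simp
      then have "real D * w > real D - 1" using D by (simp add: field_simps)
      moreover have "real D * w < real D" using w D by (simp add: W_def)
      moreover have "real D * (real D ^ n * s + w) - of_int (int D - 1) \<in> A (Suc n)"
        using 2 sub_int by blast
      ultimately show ?thesis using False by (simp add: W_def phi_def algebra_simps)
    qed
  qed
  \<comment> \<open>The base point and the two positions share an arc shorter than
    \<open>1/D\<close>: both positions are low, both are high, or they lie on either side of the
    base point. The order survives in each case.\<close>
  have phi_mono: "phi w < phi w'" if w: "w \<in> W n" "w' \<in> W n" "w < w'" for w w' n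
  proof -
    have "w' < 1 / D \<or> 1 - w < 1 / D \<or> w + 1 - w' < 1 / D"
      using rotation_unlinked.triple_gap[OF unl[of n] s_in[of n], of "real D ^ n * s + w" "real D ^ n * s + w'"] w
      by (simp add: W_def add_diff_eq)
    moreover have "1 / real D \<le> 1 / 2" using D by (simp add: field_simps)
    moreover have "real D * w < real D * w'" using w D by simp
    moreover have "real D * w < real D * w' - (real D - 1)" if "w + 1 - w' < 1 / D"
      using that D by (simp add: field_simps)
    ultimately show ?thesis using w by (auto simp: phi_def W_def)
  qed
  have phi_int: "\<exists>i::int. phi w = real D * w + i" for w
    unfolding phi_def by (auto intro: exI[of _ 0] exI[of _ "1 - int D"])
  define G where "G = phi ^^ q"
  have pow: "(phi ^^ n) w \<in> W n \<and> (phi ^^ n) w' \<in> W n \<and> (phi ^^ n) w < (phi ^^ n) w'"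
    if "w \<in> W 0" "w' \<in> W 0" "w < w'" for w w' n
    by (induction n) (use that phi_W phi_mono in auto)
  have pow_W: "(phi ^^ n) w \<in> W n" if "w \<in> W 0" for w n
    by (induction n) (use that phi_W in auto)
  have pow_int: "\<exists>i::int. (phi ^^ n) w = real D ^ n * w + i" for w n
  proof (induction n)
    case (Suc n)
    then obtain i :: int where i: "(phi ^^ n) w = real D ^ n * w + i" by blast
    obtain i' :: int where "phi ((phi ^^ n) w) = real D * (phi ^^ n) w + i'" using phi_int by blast
    then show ?case unfolding i
      by (intro exI[of _ "int D * i + i'"]) (simp add: i algebra_simps)
  qed (auto intro: exI[of _ 0])
  have "W q = W 0"
  proof -
    have "s + of_int j + w \<in> A 0 \<longleftrightarrow> s + w \<in> A 0" for w
      using rotation_unlinked.add_int[OF unl, of "s + w" 0 j] sub_int[of "s + of_int j + w" 0 j]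
      by (auto simp: algebra_simps)
    then show ?thesis by (simp add: W_def s(2) period)
  qed
  then have G_W: "G w \<in> W 0" if "w \<in> W 0" for w using pow_W[OF that, of q] by (simp add: G_def)
  have G_mono: "G w < G w'" if "w \<in> W 0" "w' \<in> W 0" "w < w'" for w w'
    using pow[OF that] by (simp add: G_def)
  have iter_W: "(G ^^ n) w \<in> W 0" if "w \<in> W 0" for w n
    by (induction n) (use that G_W in auto)
  have fixed: "G w = w" if w: "w \<in> W 0" for w
  proof (rule ccontr)
    assume ne: "G w \<noteq> w"
    \<comment> \<open>A monotone map that moves \<open>w\<close> has a strictly monotone bounded
      orbit, with limit \<open>L\<close>. The integers \<open>d n\<close> converge and are
      eventually constant, so the difference to \<open>L\<close> gets multiplied by
      \<open>real D ^ q\<close> and cannot shrink.\<close>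
    define x where "x n = (G ^^ n) w" for n
    have x_W: "x n \<in> W 0" for n using iter_W[OF w] by (simp add: x_def)
    have x_Suc: "x (Suc n) = G (x n)" for n by (simp add: x_def)
    have x01: "0 < x n" "x n < 1" for n using x_W[of n] by (auto simp: W_def)
    obtain L where L: "x \<longlonglongrightarrow> L" "(\<forall>n. x n < x (Suc n) \<and> x n \<le> L) \<or> (\<forall>n. x n > x (Suc n) \<and> x n \<ge> L)"
    proof (cases "w < G w")
      case True
      have less: "x n < x (Suc n)" for n
      proof (induction n)
        case 0 show ?case using True by (simp add: x_def)
      next
        case (Suc n) from G_mono[OF x_W x_W Suc] show ?case by (simp add: x_Suc)
      qed
      then have "incseq x" by (simp add: incseq_SucI less_imp_le)
      moreover from this obtain L where "x \<longlonglongrightarrow> L" "\<forall>i. x i \<le> L"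
        using incseq_convergent[of x 1] x01 less_imp_le by metis
      ultimately show ?thesis using that less by blast
    next
      case False
      then have False': "G w < w" using ne by simp
      have less: "x n > x (Suc n)" for n
      proof (induction n)
        case 0 show ?case using False' by (simp add: x_def)
      next
        case (Suc n) from G_mono[OF x_W x_W Suc] show ?case by (simp add: x_Suc)
      qed
      then have "decseq x" by (simp add: decseq_SucI less_imp_le)
      moreover from this obtain L where "x \<longlonglongrightarrow> L" "\<forall>i. L \<le> x i"
        using decseq_convergent[of x 0] x01 less_imp_le by metis
      ultimately show ?thesis using that less by blast
    qed
    define d where "d n = x (Suc n) - real D ^ q * x n" for n
    have d_int: "d n \<in> \<int>" for n
      using pow_int[of q "x n"] by (auto simp: d_def x_Suc G_def)
    define l where "l = L - real D ^ q * L"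
    have d_lim: "d \<longlonglongrightarrow> l"
      unfolding d_def l_def by (intro tendsto_intros L LIMSEQ_Suc)
    then have ev: "eventually (\<lambda>n. \<bar>d n - l\<bar> < 1 / 2) sequentially"
      unfolding tendsto_iff dist_real_def by (metis half_gt_zero zero_less_one)
    then obtain N where N: "\<And>n. n \<ge> N \<Longrightarrow> \<bar>d n - l\<bar> < 1 / 2"
      by (auto simp: eventually_sequentially)
    have "d n = d N" if n: "n \<ge> N" for n
    proof -
      have "\<bar>d n - d N\<bar> < 1" using N[OF n] N[of N] by linarith
      moreover have "d n - d N \<in> \<int>" using d_int by (intro Ints_diff)
      ultimately show ?thesis using Ints_nonzero_abs_less1[of "d n - d N"] by simp
    qed
    then have "eventually (\<lambda>n. d n = d N) sequentially" unfolding eventually_sequentially by blast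
    then have "d \<longlonglongrightarrow> d N" by (rule tendsto_eventually)
    then have "d N = l" using d_lim LIMSEQ_unique by blast
    then have "x (Suc N) - L = real D ^ q * (x N - L)" by (simp add: d_def l_def algebra_simps)
    moreover have P: "real D ^ q \<ge> 1" using D by simp
    have "real D ^ q * (x N - L) \<le> 1 * (x N - L)" if "x N \<le> L"
      by (rule mult_right_mono_neg[OF P]) (use that in simp)
    moreover have "1 * (x N - L) \<le> real D ^ q * (x N - L)" if "L \<le> x N"
      by (rule mult_right_mono[OF P]) (use that in simp)
    ultimately have "x N \<le> L \<Longrightarrow> x (Suc N) \<le> x N" "L \<le> x N \<Longrightarrow> x N \<le> x (Suc N)" by simp_all
    moreover have "(x N < x (Suc N) \<and> x N \<le> L) \<or> (x N > x (Suc N) \<and> x N \<ge> L)" using L(2) by blast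
    ultimately show False by linarith
  qed
  have "b - s \<in> W 0" using b by (simp add: W_def)
  from fixed[OF this] pow_int[of q "b - s"] obtain i :: int
    where "b - s = real D ^ q * (b - s) + i" by (auto simp: G_def)
  then have "(real D ^ q - 1) * (b - s) = of_int (- i)" by (simp add: algebra_simps)
  then show ?thesis by (metis Ints_of_int)
qed

section \<open>Triples of angles along an infinite orbit\<close>

locale unlinked_angles =
  fixes D :: nat and A :: "nat \<Rightarrow> real set"
  assumes D_ge_2: "D \<ge> 2"
    and add_int: "s \<in> A n \<Longrightarrow> s + of_int j \<in> A n"
    and mult: "s \<in> A n \<Longrightarrow> real D * s \<in> A (Suc n)"
    and disjoint: "n \<noteq> m \<or> \<not> int D dvd j \<Longrightarrow> a \<in> A n \<Longrightarrow> b \<in> A m \<Longrightarrow> a \<noteq> b + of_int j / D"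
    and unlinked: "n \<noteq> m \<or> \<not> int D dvd j \<Longrightarrow> a \<in> A n \<Longrightarrow> b \<in> A n \<Longrightarrow> c \<in> A m \<Longrightarrow> d \<in> A m \<Longrightarrow>
      a < c + of_int j / D \<Longrightarrow> c + of_int j / D < b \<Longrightarrow> b < d + of_int j / D \<Longrightarrow> d + of_int j / D < a + 1
      \<Longrightarrow> False"
begin

sublocale rotation_unlinked D "A n" for n
  by unfold_locales (use D_ge_2 add_int disjoint[of n n] unlinked[of n n] in blast)+

text \<open>Representatives within an arc shorter than \<open>1/D\<close>, as
  \<open>triple_gap\<close> permits. The complementary gap \<open>1 - (w - u)\<close> exceeds
  \<open>1 - 1/D\<close>, and its excess \<open>1/D - (w - u)\<close> governs the next step.\<close>

definition tri :: "nat \<Rightarrow> real \<times> real \<times> real \<Rightarrow> bool" where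
  "tri n = (\<lambda>(u, v, w). u \<in> A n \<and> v \<in> A n \<and> w \<in> A n \<and> u < v \<and> v < w \<and> w - u < 1 / D)"

lemma tri_normalize:
  assumes "a \<in> A n" "b \<in> A n" "c \<in> A n" "a < b" "b < c" "c < a + 1"
  obtains u v w where "tri n (u, v, w)"
    "v - u \<in> {b - a, c - b, a + 1 - c}" "w - v \<in> {b - a, c - b, a + 1 - c}"
proof -
  have sh: "a + 1 \<in> A n" "b + 1 \<in> A n" using add_int[of _ n 1] assms by auto
  consider "c - a < 1 / D" | "a + 1 - b < 1 / D" | "b + 1 - c < 1 / D"
    using triple_gap[OF assms] by blast
  then show ?thesis
  proof cases
    case 1 then show ?thesis using that[of a b c] assms by (simp add: tri_def)
  next
    case 2 then show ?thesis using that[of b c "a + 1"] assms sh by (simp add: tri_def)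
  next
    case 3 then show ?thesis using that[of c "a + 1" "b + 1"] assms sh by (simp add: tri_def)
  qed
qed

text \<open>Multiplication by \<open>D\<close> keeps the order and gives the cyclic gaps
  \<open>D * (v - u)\<close>, \<open>D * (w - v)\<close> and \<open>1 - D * (w - u)\<close>.
  Normalizing rotates them cyclically, and two of them become the new inner gaps.\<close>

lemma tri_step:
  fixes u v w :: real
  assumes "tri n (u, v, w)"
  obtains u' v' w' where "tri (Suc n) (u', v', w')"
    "v' - u' \<in> {D * (v - u), D * (w - v), D * (1 / D - (w - u))}"
    "w' - v' \<in> {D * (v - u), D * (w - v), D * (1 / D - (w - u))}"
proof -
  have t: "u \<in> A n" "v \<in> A n" "w \<in> A n" "u < v" "v < w" "w - u < 1 / D"
    using assms by (auto simp: tri_def)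
  have "real D * (w - u) < real D * (1 / D)" using t(6) inverse_D by (intro mult_strict_left_mono) auto
  then have *: "D * w < D * u + 1" using inverse_D by (simp add: right_diff_distrib)
  have **: "D * u < D * v" "D * v < D * w" using t inverse_D by simp_all
  have eq: "D * v - D * u = D * (v - u)" "D * w - D * v = D * (w - v)"
      "D * u + 1 - D * w = D * (1 / D - (w - u))"
    using inverse_D by (simp_all add: right_diff_distrib)
  obtain u' v' w' where "tri (Suc n) (u', v', w')"
    "v' - u' \<in> {D * v - D * u, D * w - D * v, D * u + 1 - D * w}"
    "w' - v' \<in> {D * v - D * u, D * w - D * v, D * u + 1 - D * w}"
    by (rule tri_normalize[OF mult[OF t(1)] mult[OF t(2)] mult[OF t(3)] ** *]) blast
  then show ?thesis unfolding eq by (rule that)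
qed

lemma tri_less: "tri n (u, v, w) \<Longrightarrow> w < u + 1 / 2"
  using inverse_D(1) unfolding tri_def case_prod_conv by linarith

text \<open>Of three displacements two have the same sign. Each is smaller than half of every gap,
  so the two corresponding pairs interlace, and angles of different times are linked.\<close>

lemma no_close_triples:
  assumes "n \<noteq> m" "tri n (u, v, w)" "tri m (u', v', w')"
    and "\<bar>u - u' - of_int i\<bar> < e" "\<bar>v - v' - of_int i\<bar> < e" "\<bar>w - w' - of_int i\<bar> < e"
    and gaps: "v - u \<ge> 2 * e" "w - v \<ge> 2 * e" "v' - u' \<ge> 2 * e" "w' - v' \<ge> 2 * e" "2 * e \<le> 1 / 2"
  shows False
proof -
  have t: "u \<in> A n" "v \<in> A n" "w \<in> A n" "w < u + 1 / 2"
    and t': "u' \<in> A m" "v' \<in> A m" "w' \<in> A m" "w' < u' + 1 / 2"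
    using assms(2,3) tri_less[OF assms(2)] tri_less[OF assms(3)] by (auto simp: tri_def)
  \<comment> \<open>The integer shift \<open>i\<close> is written as a fraction with denominator
    \<open>D\<close> to fit the form of the locale assumptions.\<close>
  define u'' v'' w'' where "u'' = u' + of_int (i * int D) / D" and "v'' = v' + of_int (i * int D) / D"
    and "w'' = w' + of_int (i * int D) / D"
  have sh: "of_int (i * int D) / D = (of_int i :: real)" using inverse_D by simp
  note dis = disjoint[OF disjI1[OF assms(1)], of _ _ "i * int D"]
  have ne: "u \<noteq> u''" "v \<noteq> v''" "w \<noteq> w''" using dis t t' by (auto simp: u''_def v''_def w''_def)
  have near: "\<bar>u - u''\<bar> < e" "\<bar>v - v''\<bar> < e" "\<bar>w - w''\<bar> < e"
    using assms(4-6) unfolding u''_def v''_def w''_def sh by (auto simp: abs_if split: if_splits)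
  have gaps'': "v'' - u'' \<ge> 2 * e" "w'' - v'' \<ge> 2 * e" "w'' < u'' + 1 / 2"
    using gaps t' by (auto simp: u''_def v''_def w''_def)
  have link: "\<not> (a < c + of_int (i * int D) / D \<and> c + of_int (i * int D) / D < b \<and>
      b < d + of_int (i * int D) / D \<and> d + of_int (i * int D) / D < a + 1)"
    if "a \<in> A n" "b \<in> A n" "c \<in> A m" "d \<in> A m" for a b c d
    using unlinked[OF disjI1[OF assms(1)] that] by blast
  have link': "\<not> (c + of_int (i * int D) / D < a \<and> a < d + of_int (i * int D) / D \<and>
      d + of_int (i * int D) / D < b \<and> b < c + of_int (i * int D) / D + 1)"
    if "a \<in> A n" "b \<in> A n" "c \<in> A m" "d \<in> A m" for a b c d
    using unlinked[OF disjI1[OF assms(1)[symmetric]] that(3,4,1,2), of "- (i * int D)"]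
    by (auto simp: field_simps)
  consider "u < u''" "v < v''" | "u > u''" "v > v''" | "u < u''" "w < w''" | "u > u''" "w > w''"
    | "v < v''" "w < w''" | "v > v''" "w > w''" using ne by linarith
  then show False
  proof cases
    case 1 then show ?thesis using link[of u v u' v'] t t' near gaps gaps''
      unfolding u''_def[symmetric] v''_def[symmetric] by (auto simp: abs_if split: if_splits)
  next
    case 2 then show ?thesis using link'[of u v u' v'] t t' near gaps gaps''
      unfolding u''_def[symmetric] v''_def[symmetric] by (auto simp: abs_if split: if_splits)
  next
    case 3 then show ?thesis using link[of u w u' w'] t t' near gaps gaps''
      unfolding u''_def[symmetric] w''_def[symmetric] by (auto simp: abs_if split: if_splits)
  next
    case 4 then show ?thesis using link'[of u w u' w'] t t' near gaps gaps''
      unfolding u''_def[symmetric] w''_def[symmetric] by (auto simp: abs_if split: if_splits)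
  next
    case 5 then show ?thesis using link[of v w v' w'] t t' near gaps gaps''
      unfolding v''_def[symmetric] w''_def[symmetric] by (auto simp: abs_if split: if_splits)
  next
    case 6 then show ?thesis using link'[of v w v' w'] t t' near gaps gaps''
      unfolding v''_def[symmetric] w''_def[symmetric] by (auto simp: abs_if split: if_splits)
  qed
qed

text \<open>If all gaps were at least \<open>e\<close>, then sorting the triples, translated by the
  integer part of \<open>u n\<close>, into finitely many cells would put two times into one cell,
  against \<open>no_close_triples\<close>.\<close>

lemma tri_small_gap:
  assumes tri: "\<And>n. tri n (u n, v n, w n)" and e: "e > 0"
  shows "\<exists>n. v n - u n < e \<or> w n - v n < e"
proof (rule ccontr)
  assume *: "\<not> ?thesis"
  \<comment> \<open>The cell size: gaps are at least \<open>2 * d\<close>, and \<open>2 * d\<close>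
    is at most \<open>1 / 2\<close>. The cells cover \<open>{0..2}\<close>, which contains all
    translated entries since \<open>w n < u n + 1\<close>.\<close>
  define d where "d = min e (1 / 4) / 4"
  have d: "0 < d" "4 * d \<le> e" "4 * d \<le> 1 / 4" using e by (auto simp: d_def)
  define h where "h n = (\<lfloor>frac (u n) / d\<rfloor>, \<lfloor>(v n - \<lfloor>u n\<rfloor>) / d\<rfloor>, \<lfloor>(w n - \<lfloor>u n\<rfloor>) / d\<rfloor>)" for n
  define N where "N = \<lceil>2 / d\<rceil>"
  have cell: "\<lfloor>x / d\<rfloor> \<in> {0..N}" if "0 \<le> x" "x \<le> 2" for x :: real
  proof -
    have "x / d \<le> 2 / d" using that d by (intro divide_right_mono) auto
    moreover have "0 \<le> x / d" using that d by simp
    ultimately show ?thesis unfolding N_def by (simp add: floor_le_iff le_floor_iff) linarith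
  qed
  have h_in: "h n \<in> {0..N} \<times> {0..N} \<times> {0..N}" for n
  proof -
    have "0 \<le> frac (u n)" "frac (u n) < 1" "frac (u n) = u n - \<lfloor>u n\<rfloor>"
      using frac_lt_1 frac_ge_0 by (auto simp: frac_def)
    moreover have "u n - \<lfloor>u n\<rfloor> \<ge> 0" by simp
    moreover have "u n < v n" "v n < w n" "w n < u n + 1"
      using tri[of n] tri_less[OF tri[of n]] by (auto simp: tri_def)
    ultimately show ?thesis unfolding h_def by (simp del: atLeastAtMost_iff of_int_floor_le) (intro conjI cell; linarith)
  qed
  have "finite (range h)"
    by (rule finite_subset[of _ "{0..N} \<times> {0..N} \<times> {0..N}"]) (use h_in in blast, simp)
  then have "\<not> inj h" using finite_imageD infinite_UNIV_nat by blast
  then obtain n m where nm: "n \<noteq> m" "h n = h m" by (auto simp: inj_def)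
  define i where "i = \<lfloor>u n\<rfloor> - \<lfloor>u m\<rfloor>"
  have close: "\<bar>x - y\<bar> < d" if "\<lfloor>x / d\<rfloor> = \<lfloor>y / d\<rfloor>" for x y :: real
  proof -
    have "\<bar>x / d - y / d\<bar> < 1" using that by linarith
    then show ?thesis using d by (simp add: diff_divide_distrib[symmetric])
  qed
  have cl: "\<bar>frac (u n) - frac (u m)\<bar> < d" "\<bar>(v n - \<lfloor>u n\<rfloor>) - (v m - \<lfloor>u m\<rfloor>)\<bar> < d"
      "\<bar>(w n - \<lfloor>u n\<rfloor>) - (w m - \<lfloor>u m\<rfloor>)\<bar> < d"
    using nm(2) by (auto simp: h_def intro!: close)
  have gap: "v k - u k \<ge> 2 * d" "w k - v k \<ge> 2 * d" for k
  proof -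
    have "v k - u k \<ge> e" "w k - v k \<ge> e" using * by (meson not_less)+
    then show "v k - u k \<ge> 2 * d" "w k - v k \<ge> 2 * d" using d by linarith+
  qed
  show False
    by (rule no_close_triples[OF nm(1) tri[of n] tri[of m], of i d])
       (use gap[of n] gap[of m] cl d in \<open>auto simp: frac_def i_def algebra_simps\<close>)
qed

text \<open>No wandering triangles. The complementary gap of a triple has size \<open>1 - 1/D + \<epsilon>\<close> and
  produces a gap \<open>D \<epsilon>\<close> in the next generation; the other gaps are multiplied by \<open>D\<close>. Take
  a small \<open>\<epsilon>\<close> and the first triple with a smaller value: its gaps are at least \<open>D \<epsilon>\<close>, but
  unlinkedness with the rotations of the \<open>\<epsilon>\<close>-triple squeezes one of them below \<open>\<epsilon>\<close>.\<close>

lemma no_wandering_triangle: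
  assumes "a \<in> A 0" "b \<in> A 0" "c \<in> A 0" "a < b" "b < c" "c < a + 1"
  shows False
proof -
  obtain T0 where T0: "tri 0 T0" by (rule tri_normalize[OF assms])
  define R :: "nat \<Rightarrow> real \<times> real \<times> real \<Rightarrow> real \<times> real \<times> real \<Rightarrow> bool" where "R = (\<lambda>n T T'. case T of (u, v, w) \<Rightarrow> case T' of (u', v', w') \<Rightarrow>
    v' - u' \<in> {real D * (v - u), real D * (w - v), real D * (1 / D - (w - u))} \<and>
    w' - v' \<in> {real D * (v - u), real D * (w - v), real D * (1 / D - (w - u))})"
  have "\<exists>T'. tri (Suc n) T' \<and> R n T T'" if "tri n T" for n T
  proof -
    obtain u v w where T: "T = (u, v, w)" by (cases T)
    show ?thesis using tri_step[of n u v w] that unfolding T R_def by (smt (verit) case_prod_conv)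
  qed
  then obtain T where T: "\<And>n. tri n (T n)" "\<And>n. R n (T n) (T (Suc n))"
    using dependent_nat_choice[of tri R] T0 by metis
  define u v w where "u n = fst (T n)" and "v n = fst (snd (T n))" and "w n = snd (snd (T n))" for n
  have T_eq: "T n = (u n, v n, w n)" for n by (simp add: u_def v_def w_def)
  define p q \<epsilon> where "p n = v n - u n" and "q n = w n - v n" and "\<epsilon> n = 1 / D - (w n - u n)" for n
  have tri: "tri n (u n, v n, w n)" for n using T(1)[of n] by (simp add: T_eq)
  have in_A: "u n \<in> A n" "v n \<in> A n" "w n \<in> A n" and pos: "p n > 0" "q n > 0" "\<epsilon> n > 0" for n
    using tri[of n] by (auto simp: tri_def p_def q_def \<epsilon>_def)
  have step: "p (Suc n) \<in> {D * p n, D * q n, D * \<epsilon> n}" "q (Suc n) \<in> {D * p n, D * q n, D * \<epsilon> n}" for n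
    using T(2)[of n] by (auto simp: R_def T_eq p_def q_def \<epsilon>_def)
  define m0 where "m0 = min (p 0) (q 0)"
  have m0: "m0 > 0" using pos by (simp add: m0_def)
  \<comment> \<open>A new gap is \<open>D\<close> times an old one, hence larger, or it is
    \<open>D * \<epsilon> k\<close> for an earlier time \<open>k\<close>.\<close>
  have lower: "p n \<ge> min m0 (D * e) \<and> q n \<ge> min m0 (D * e)" if "\<And>k. k < n \<Longrightarrow> \<epsilon> k \<ge> e" for n and e :: real
    using that
  proof (induction n)
    case (Suc n)
    have grow: "x \<le> D * x" if "x > 0" for x :: real
      using that inverse_D mult_right_mono[of 1 "real D" x] by simp
    have "min m0 (D * e) \<le> D * p n" "min m0 (D * e) \<le> D * q n"
      using Suc grow[of "p n"] grow[of "q n"] pos by (meson less_Suc_eq order_trans)+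
    moreover have "min m0 (D * e) \<le> D * \<epsilon> n"
      using Suc.prems[of n] inverse_D by (simp add: min_le_iff_disj)
    ultimately show ?case using step[of n] by auto
  qed (auto simp: m0_def)
  have inf0: "\<exists>n. \<epsilon> n < e" if e: "e > 0" for e :: real
  proof (rule ccontr)
    assume "\<not> ?thesis"
    then have "\<And>n. p n \<ge> min m0 (D * e) \<and> q n \<ge> min m0 (D * e)" using lower by (simp add: not_less)
    moreover have "min m0 (D * e) > 0" using m0 e D_ge_2 by simp
    ultimately show False using tri_small_gap[OF tri, of "min m0 (D * e)"]
      unfolding p_def q_def by (meson not_less)
  qed
  \<comment> \<open>The first bound makes \<open>D * e\<close> smaller than \<open>m0\<close>, so
    that \<open>lower\<close> yields \<open>D * e\<close>; the second gives
    \<open>2 * e < 1 / D\<close>, so that the width \<open>l\<close> of triple \<open>n\<close>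
    exceeds \<open>e\<close>.\<close>
  define \<theta> :: real where "\<theta> = min (m0 / D) (1 / (2 * D))"
  have th: "\<theta> > 0" using m0 D_ge_2 by (simp add: \<theta>_def)
  obtain n where n: "\<epsilon> n < \<theta>" using inf0[OF th] by blast
  define m where "m = (LEAST m. \<epsilon> m < \<epsilon> n)"
  have m: "\<epsilon> m < \<epsilon> n" unfolding m_def by (rule LeastI_ex[OF inf0[OF pos(3)]])
  have m_min: "\<epsilon> k \<ge> \<epsilon> n" if "k < m" for k
    using not_less_Least[OF that[unfolded m_def]] by (simp only: not_less)
  have ne: "m \<noteq> n" using m by auto
  define e where "e = \<epsilon> n"
  have e: "e > 0" "D * e < m0" "2 * e < 1 / D"
    using pos(3)[of n] n D_ge_2 by (auto simp: e_def \<theta>_def field_simps)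
  have "min m0 (D * e) = D * e" using e by simp
  then have big: "p m \<ge> D * e" "q m \<ge> D * e" using lower[of m e] m_min by (auto simp: e_def)
  moreover have "D * e > e" using e inverse_D mult_strict_right_mono[of 1 "real D" e] by simp
  ultimately have big: "p m > e" "q m > e" by auto
  define l where "l = w n - u n"
  have l1: "1 / D = l + e" unfolding l_def e_def \<epsilon>_def by simp
  with e(3) have l: "1 / D = l + e" "l > e" by auto
  have l': "w m - u m > l" "w m - u m < 1 / D" using m pos(3)[of m] unfolding l_def \<epsilon>_def by linarith+
  \<comment> \<open>The rotated ends of triple \<open>n\<close> cut the line alternately into
    intervals of length \<open>l\<close>, from \<open>U j\<close> to \<open>W j\<close>, and of
    length \<open>e\<close>, from \<open>W j\<close> to \<open>U (j + 1)\<close>.\<close>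
  define U W where "U j = u n + of_int j / D" and "W j = w n + of_int j / D" for j
  have UW: "W j = U j + l" "U (j + 1) = W j + e" for j
  proof -
    have "of_int (j + 1) / real D = of_int j / D + 1 / D" by (simp add: add_divide_distrib)
    then show "W j = U j + l" "U (j + 1) = W j + e"
      using l(1) unfolding U_def W_def l_def by linarith+
  qed
  have D1: "1 / real D \<le> 1 / 2" by (rule inverse_D)
  have avoid: "x \<noteq> U j" "x \<noteq> W j" if "x \<in> A m" for x j
    using disjoint[OF disjI1[OF ne] that in_A(1)[of n], of j]
      disjoint[OF disjI1[OF ne] that in_A(3)[of n], of j] unfolding U_def W_def by blast+
  have link: False if "x \<in> A m" "y \<in> A m" "x < U j" "U j < y" "y < W j" "W j < x + 1" for x y j
    using unlinked[OF disjI1[OF ne] that(1,2) in_A(1)[of n] in_A(3)[of n], of j] that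
    unfolding U_def W_def by blast
  have link': False if "x \<in> A m" "y \<in> A m" "U j < x" "x < W j" "W j < y" "y < U j + 1" for x y j
    using unlinked[OF disjI1[OF ne[symmetric]] in_A(1)[of n] in_A(3)[of n] that(1,2), of "- j"] that
    unfolding U_def W_def by (simp add: algebra_simps)
  define j where "j = \<lfloor>(u m - u n) * D\<rfloor>"
  have "of_int j \<le> (u m - u n) * D" "(u m - u n) * D < of_int j + 1" by (auto simp: j_def)
  then have "U j \<le> u m" "u m < U (j + 1)"
    using inverse_D by (auto simp: U_def field_simps)
  then have um: "U j < u m" "u m < U (j + 1)" using avoid(1)[OF in_A(1)[of m], of j] by auto
  \<comment> \<open>If \<open>u m\<close> were in an interval of length \<open>l\<close>, the wider
    triple \<open>m\<close> would end beyond it and be linked with the ends of that interval. So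
    \<open>u m\<close> lies in an interval of length \<open>e\<close>, and similarly
    \<open>w m\<close> in the next one. Unlinkedness also keeps \<open>v m\<close> out of the long
    interval in between, so it shares a short one with \<open>u m\<close> or \<open>w m\<close>,
    whereas both gaps exceed \<open>e\<close>.\<close>
  have "W j < u m"
  proof (rule ccontr)
    assume "\<not> ?thesis"
    then have "u m < W j" using avoid(2)[OF in_A(1)[of m], of j] by auto
    moreover from this have "w m < U j + 1" using l' UW[of j] l D1 by linarith
    ultimately show False using link'[OF in_A(1) in_A(3) um(1)] l' UW[of j] um by linarith
  qed
  have wm: "w m > U (j + 1)" "w m < U (j + 1) + 1 / D"
    using \<open>W j < u m\<close> l' l UW[of j] um by auto
  have W1: "W (j + 1) < u m + 1" using UW[of j] UW[of "j + 1"] \<open>W j < u m\<close> l D1 by linarith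
  have "W (j + 1) < w m"
    using link[OF in_A(1) in_A(3) um(2) wm(1) _ W1] avoid(2)[OF in_A(3)[of m], of "j + 1"] by fastforce
  have "v m < U (j + 1) \<or> W (j + 1) < v m"
    using link[OF in_A(1) in_A(2) um(2) _ _ W1] avoid[OF in_A(2)[of m], of "j + 1"] by fastforce
  then show False
  proof
    assume "v m < U (j + 1)"
    then show False using big(1) UW[of j] \<open>W j < u m\<close> by (simp add: p_def)
  next
    assume "W (j + 1) < v m"
    then show False using big(2) UW[of j] UW[of "j + 1"] wm l by (simp add: q_def)
  qed
qed

end

section \<open>Rays near a repelling periodic point\<close>

lemma first_exit_time:
  fixes g :: "real \<Rightarrow> real"
  assumes cont: "continuous_on {a..} g" and a: "g a \<le> \<rho>" and b: "b \<ge> a" "g b \<ge> \<rho>"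
  obtains T where "T \<ge> a" "g T = \<rho>" "\<And>t. a \<le> t \<Longrightarrow> t < T \<Longrightarrow> g t < \<rho>"
proof -
  define S where "S = {a..} \<inter> g -` {\<rho>..}"
  have "closed S" unfolding S_def
    by (rule continuous_closed_preimage[OF cont]) auto
  moreover have "S \<noteq> {}" "bdd_below S" using b by (auto simp: S_def)
  ultimately have "Inf S \<in> S" by (intro closed_contains_Inf) auto
  define T where "T = Inf S"
  have T: "T \<ge> a" "g T \<ge> \<rho>" using \<open>Inf S \<in> S\<close> by (auto simp: T_def S_def)
  have min: "g t < \<rho>" if "a \<le> t" "t < T" for t
  proof (rule ccontr)
    assume "\<not> ?thesis"
    then have "t \<in> S" using that by (simp add: S_def)
    then have "T \<le> t" unfolding T_def by (intro cInf_lower \<open>bdd_below S\<close>)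
    then show False using that by simp
  qed
  have "continuous_on {a..T} g" using cont by (rule continuous_on_subset) auto
  then obtain t where t: "a \<le> t" "t \<le> T" "g t = \<rho>" using IVT'[of g a \<rho> T] a T by blast
  then have "t = T" using min[of t] by force
  then show ?thesis using that T t min by blast
qed

text \<open>A packing bound; it will limit the number of components that have a large disc in a
  given annulus.\<close>

lemma separated_points_bounded:
  fixes S :: "'a::metric_space set" and c :: real
  assumes "compact S" "c > 0"
  obtains k where "\<And>X. X \<subseteq> S \<Longrightarrow> (\<And>x y. x \<in> X \<Longrightarrow> y \<in> X \<Longrightarrow> x \<noteq> y \<Longrightarrow> dist x y \<ge> c) \<Longrightarrow> card X \<le> k"
proof -
  obtain C where C: "finite C" "S \<subseteq> (\<Union>x\<in>C. ball x (c / 2))"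
    using seq_compact_imp_totally_bounded[of S] assms compact_imp_seq_compact
    by (metis half_gt_zero)
  show ?thesis
  proof (rule that[of "card C"])
    fix X assume X: "X \<subseteq> S" "\<And>x y. x \<in> X \<Longrightarrow> y \<in> X \<Longrightarrow> x \<noteq> y \<Longrightarrow> dist x y \<ge> c"
    have "\<forall>x\<in>X. \<exists>z\<in>C. dist z x < c / 2" using X(1) C(2) by (auto simp: subset_iff)
    then obtain h where h: "\<And>x. x \<in> X \<Longrightarrow> h x \<in> C" "\<And>x. x \<in> X \<Longrightarrow> dist (h x) x < c / 2" by metis
    have "inj_on h X"
    proof (rule inj_onI, rule ccontr)
      fix x y assume xy: "x \<in> X" "y \<in> X" "h x = h y" "x \<noteq> y"
      have "dist x y \<le> dist (h x) x + dist (h x) y" by (metis dist_commute dist_triangle)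
      then show False using h(2)[OF xy(1)] h(2)[OF xy(2)] X(2)[OF xy(1,2,4)] xy(3) by simp
    qed
    then show "card X \<le> card C" using h(1) by (intro card_inj_on_le[of h]) (auto simp: C(1))
  qed
qed

lemma repelling_inverse_branch:
  fixes F :: "complex \<Rightarrow> complex"
  assumes F: "F holomorphic_on UNIV" "F y = y" "norm (deriv F y) > 1"
  obtains r h \<mu> where "r > 0" "\<mu> > 1" "h holomorphic_on ball y r"
    "\<And>z. z \<in> ball y r \<Longrightarrow> h z \<in> ball y r" "\<And>z. z \<in> ball y r \<Longrightarrow> F (h z) = z"
    "\<And>z. z \<in> ball y r \<Longrightarrow> norm (h z - y) \<le> norm (z - y) / \<mu>"
proof -
  have "deriv F y \<noteq> 0" using F(3) by auto
  then obtain s where s: "s > 0" "open (F ` ball y s)" "inj_on F (ball y s)"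
    using has_complex_derivative_locally_invertible[OF F(1)] by (metis UNIV_I open_UNIV)
  have holF: "F holomorphic_on ball y s" using F(1) holomorphic_on_subset by blast
  obtain h where h: "h holomorphic_on (F ` ball y s)"
    "\<And>z. z \<in> ball y s \<Longrightarrow> deriv F z * deriv h (F z) = 1" "\<And>z. z \<in> ball y s \<Longrightarrow> h (F z) = z"
    using holomorphic_has_inverse[OF holF open_ball s(3)] by blast
  have y: "y \<in> ball y s" "y \<in> F ` ball y s" using s(1) F(2) by (auto simp: image_iff intro!: bexI[of _ y])
  have hy: "h y = y" using h(3)[OF y(1)] F(2) by simp
  have dh: "norm (deriv h y) = 1 / norm (deriv F y)"
  proof (rule eq_divide_imp)
    show "norm (deriv h y) * norm (deriv F y) = 1"
      using h(2)[OF y(1)] unfolding F(2) by (metis mult.commute norm_mult norm_one)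
  qed (use F(3) in auto)
  \<comment> \<open>Any number strictly between \<open>1\<close> and the modulus of the multiplier
    works; the strictness absorbs the error of the linear approximation.\<close>
  define \<mu> where "\<mu> = (1 + norm (deriv F y)) / 2"
  have \<mu>: "\<mu> > 1" "\<mu> < norm (deriv F y)" using F(3) by (auto simp: \<mu>_def)
  have lt: "norm (deriv h y) < 1 / \<mu>" unfolding dh using \<mu> by (simp add: frac_less2)
  have "(h has_field_derivative deriv h y) (at y)"
    using h(1) s(2) y(2) holomorphic_derivI by blast
  then have "((\<lambda>z. norm ((h z - y) / (z - y))) \<longlongrightarrow> norm (deriv h y)) (at y)"
    unfolding has_field_derivative_iff hy by (rule tendsto_norm)
  then have "eventually (\<lambda>z. norm ((h z - y) / (z - y)) < 1 / \<mu>) (at y)"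
    using lt by (rule order_tendstoD)
  then obtain d where d: "d > 0" "\<And>z. z \<noteq> y \<Longrightarrow> dist z y < d \<Longrightarrow> norm ((h z - y) / (z - y)) < 1 / \<mu>"
    unfolding eventually_at by blast
  obtain e where e: "e > 0" "ball y e \<subseteq> F ` ball y s" using s(2) y(2) open_contains_ball by blast
  define r where "r = min d e"
  have r: "r > 0" "r \<le> d" "r \<le> e" using d e by (auto simp: r_def)
  have est: "norm (h z - y) \<le> norm (z - y) / \<mu>" if "z \<in> ball y r" for z
  proof (cases "z = y")
    case False
    then have "norm (h z - y) / norm (z - y) < 1 / \<mu>"
      using d(2)[of z] that r by (simp add: dist_commute norm_divide)
    then show ?thesis using False by (simp add: field_simps)
  qed (simp add: hy)
  show ?thesis
  proof (rule that[of r \<mu> h])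
    show "h holomorphic_on ball y r" using h(1) e r by (meson holomorphic_on_subset subset_ball subset_trans)
    fix z assume z: "z \<in> ball y r"
    have "norm (z - y) / \<mu> \<le> norm (z - y)" using \<mu> by (simp add: divide_le_eq mult_left_le mult_le_cancel_left1)
    then show "h z \<in> ball y r" using est[OF z] z by (simp add: dist_norm norm_minus_commute)
    have "z \<in> F ` ball y s" using z e r by fastforce
    then obtain w where "w \<in> ball y s" "z = F w" by blast
    then show "F (h z) = z" using h(3)[of w] by simp
  qed (use r \<mu> est in auto)
qed

context boettcher_unicritical
begin

text \<open>A logarithm of \<open>Psi - k\<close> is injective modulo \<open>2\<pi>i\<close>, so by Bloch's theorem its derivative is
  bounded. This replaces the Koebe distortion theorem.\<close>

lemma norm_deriv_Psi_le:
  assumes \<rho>: "0 < \<rho>" "\<rho> \<le> Re Z" "\<rho> \<le> pi" and k: "k \<in> K"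
  shows "norm (deriv Psi Z) * \<rho> \<le> 24 * pi * norm (Psi Z - k)"
proof (rule ccontr)
  assume *: "\<not> ?thesis"
  have sub: "ball Z \<rho> \<subseteq> {Z. Re Z > 0}"
  proof
    fix W assume "W \<in> ball Z \<rho>"
    then have "\<bar>Re (Z - W)\<bar> < \<rho>" using abs_Re_le_cmod[of "Z - W"] by (simp add: dist_norm)
    then show "W \<in> {Z. Re Z > 0}" using \<rho> by simp
  qed
  have hol: "(\<lambda>W. Psi W - k) holomorphic_on ball Z \<rho>"
    using holomorphic_on_subset[OF holomorphic_Psi sub] by (intro holomorphic_intros)
  have nz: "Psi W - k \<noteq> 0" if "W \<in> ball Z \<rho>" for W
    using Psi_notin_K[of W] that sub k by auto
  have Z: "Z \<in> ball Z \<rho>" using \<rho> by simp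
  obtain L where L: "L holomorphic_on ball Z \<rho>" "\<And>W. W \<in> ball Z \<rho> \<Longrightarrow> exp (L W) = Psi W - k"
    using holomorphic_logarithm_exists[OF convex_ball open_ball hol nz Z] by metis
  have dL: "(L has_field_derivative deriv L Z) (at Z)"
    using L(1) Z open_ball holomorphic_derivI by blast
  have "((\<lambda>W. exp (L W)) has_field_derivative exp (L Z) * deriv L Z) (at Z)"
    by (rule DERIV_fun_exp[OF dL])
  moreover have "((\<lambda>W. Psi W - k) has_field_derivative deriv Psi Z) (at Z)"
    using holomorphic_derivI[OF holomorphic_Psi open_right_half, of Z] \<rho>
    by (auto intro!: derivative_eq_intros)
  then have "((\<lambda>W. exp (L W)) has_field_derivative deriv Psi Z) (at Z)"
    by (rule has_field_derivative_transform_within_open[OF _ open_ball Z]) (simp add: L(2))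
  ultimately have "exp (L Z) * deriv L Z = deriv Psi Z" by (rule DERIV_unique)
  then have eq: "norm (deriv Psi Z) = norm (Psi Z - k) * norm (deriv L Z)"
    using L(2)[OF Z] by (simp add: norm_mult[symmetric])
  \<comment> \<open>Bloch's theorem yields a disc of radius
    \<open>\<rho> * norm (deriv L Z) / 12\<close>. The factor \<open>24 * pi\<close> makes this at
    least \<open>2 * pi\<close>, enough for two values of \<open>L\<close> that differ by
    \<open>2 * pi * \<i>\<close>.\<close>
  have "norm (Psi Z - k) * (24 * pi) \<le> norm (Psi Z - k) * (\<rho> * norm (deriv L Z))"
    using * unfolding eq by (simp add: mult_ac)
  then have big: "2 * pi \<le> \<rho> * norm (deriv L Z) / 12" using nz[OF Z] by simp
  obtain b where b: "ball b (2 * pi) \<subseteq> L ` ball Z \<rho>"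
    using Bloch[OF L(1) \<rho>(1) big] by blast
  have "b + of_real pi * \<i> \<in> ball b (2 * pi)" "b - of_real pi * \<i> \<in> ball b (2 * pi)"
    by (auto simp: dist_norm norm_mult)
  then have "b + of_real pi * \<i> \<in> L ` ball Z \<rho>" "b - of_real pi * \<i> \<in> L ` ball Z \<rho>"
    using b by (meson subsetD)+
  then obtain W1 W2 where W: "W1 \<in> ball Z \<rho>" "b + of_real pi * \<i> = L W1" "W2 \<in> ball Z \<rho>" "b - of_real pi * \<i> = L W2"
    by (elim imageE)
  note W = W(1) W(2)[symmetric] W(3) W(4)[symmetric]
  have "L W1 = L W2 + of_real (of_int (2 * 1) * pi) * \<i>" unfolding W(2,4) by simp
  then have "exp (L W1) = exp (L W2)" unfolding exp_eq by blast
  then have "Psi W1 = Psi W2" unfolding L(2)[OF W(1)] L(2)[OF W(3)] by simp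
  moreover have "Re W1 > 0" "Re W2 > 0" using sub W(1,3) by auto
  ultimately have "exp W1 = exp W2" using Psi_eq_iff by simp
  then obtain n :: int where n: "W1 = W2 + of_real (of_int (2 * n) * pi) * \<i>" using exp_eq by blast
  \<comment> \<open>The points differ by a multiple of \<open>2 * pi * \<i>\<close>, and the disc
    has diameter at most \<open>2 * pi\<close>, so they coincide.\<close>
  have "dist W1 W2 < \<rho> + \<rho>" using W by (metis add_strict_mono dist_commute dist_triangle_less_add mem_ball)
  then have "\<bar>real_of_int n\<bar> * pi < \<rho>" using n by (simp add: dist_norm norm_mult abs_mult)
  then have "\<bar>real_of_int n\<bar> * pi < 1 * pi" using \<rho>(3) by linarith
  then have "\<bar>real_of_int n\<bar> < 1" by (simp only: mult_less_cancel_right) auto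
  then have "n = 0" by linarith
  then have "W1 = W2" using n by simp
  then show False using W(2,4) by simp
qed

text \<open>With the logarithm of the potential as time, \<open>norm_deriv_Psi_le\<close> bounds the
  speed of a ray by \<open>C\<close> times its distance to any point of \<open>K\<close>. A ray
  closer to \<open>K\<close> than the stated bound throughout a time at most \<open>A\<close> would
  cover at most half of \<open>\<rho>2 - \<rho>1\<close>.\<close>

lemma ray_crossing:
  assumes C: "C = 24 * pi / min 1 (pi / t1)" and t1: "t1 > 0"
    and \<tau>: "\<alpha> \<le> \<beta>" "exp \<beta> \<le> t1" "\<beta> - \<alpha> \<le> A" "A > 0"
    and \<rho>: "norm (Psi (Complex (exp \<alpha>) \<theta>) - y) = \<rho>1" "norm (Psi (Complex (exp \<beta>) \<theta>) - y) = \<rho>2" "\<rho>1 < \<rho>2"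
  shows "\<exists>\<tau>\<in>{\<alpha>..\<beta>}. \<forall>k\<in>K. norm (Psi (Complex (exp \<tau>) \<theta>) - k) \<ge> (\<rho>2 - \<rho>1) / (2 * C * A)"
proof (rule ccontr)
  define \<gamma> where "\<gamma> \<tau> = Psi (Complex (exp \<tau>) \<theta>)" for \<tau>
  \<comment> \<open>\<open>norm_deriv_Psi_le\<close> needs a radius at most \<open>pi\<close>;
    \<open>\<kappa> * exp \<tau>\<close> is one for all potentials up to \<open>t1\<close>.\<close>
  define \<kappa> where "\<kappa> = min 1 (pi / t1)"
  define \<delta> where "\<delta> = (\<rho>2 - \<rho>1) / (2 * C * A)"
  have \<kappa>: "\<kappa> > 0" "\<kappa> \<le> 1" "\<kappa> * t1 \<le> pi"
  proof -
    show "\<kappa> > 0" "\<kappa> \<le> 1" using t1 by (auto simp: \<kappa>_def)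
    have "\<kappa> * t1 \<le> pi / t1 * t1" using t1 by (intro mult_right_mono) (auto simp: \<kappa>_def)
    then show "\<kappa> * t1 \<le> pi" using t1 by simp
  qed
  have C0: "C > 0" using C \<kappa> by (simp add: \<kappa>_def)
  assume "\<not> ?thesis"
  then have near: "\<exists>k\<in>K. norm (\<gamma> \<tau> - k) < \<delta>" if "\<tau> \<in> {\<alpha>..\<beta>}" for \<tau>
    using that by (auto simp: \<gamma>_def \<delta>_def not_le)
  have der: "(\<gamma> has_vector_derivative (of_real (exp \<tau>) * deriv Psi (Complex (exp \<tau>) \<theta>))) (at \<tau> within {\<alpha>..\<beta>})" for \<tau>
  proof -
    have "((\<lambda>\<tau>. of_real (exp \<tau>) + \<i> * of_real \<theta>) has_vector_derivative of_real (exp \<tau>)) (at \<tau> within {\<alpha>..\<beta>})"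
      by (auto intro!: derivative_eq_intros has_vector_derivative_of_real simp: has_real_derivative_iff_has_vector_derivative[symmetric])
    then have 1: "((\<lambda>\<tau>. Complex (exp \<tau>) \<theta>) has_vector_derivative of_real (exp \<tau>)) (at \<tau> within {\<alpha>..\<beta>})"
      by (simp add: Complex_eq)
    have 2: "(Psi has_field_derivative deriv Psi (Complex (exp \<tau>) \<theta>)) (at (Complex (exp \<tau>) \<theta>))"
      by (rule holomorphic_derivI[OF holomorphic_Psi open_right_half]) simp
    show ?thesis
      using field_vector_diff_chain_within[OF 1 has_field_derivative_at_within[OF 2]]
      by (simp add: \<gamma>_def[abs_def] o_def)
  qed
  have bound: "norm (of_real (exp \<tau>) * deriv Psi (Complex (exp \<tau>) \<theta>)) \<le> C * \<delta>" if \<tau>': "\<tau> \<in> {\<alpha>..\<beta>}" for \<tau>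
  proof -
    obtain k where k: "k \<in> K" "norm (\<gamma> \<tau> - k) < \<delta>" using near[OF \<tau>'] by blast
    have "exp \<tau> \<le> t1" using \<tau>(2) \<tau>' by (meson atLeastAtMost_iff exp_le_cancel_iff order_trans)
    then have "\<kappa> * exp \<tau> \<le> pi" using \<kappa> by (meson mult_left_mono less_imp_le order_trans)
    then have "norm (deriv Psi (Complex (exp \<tau>) \<theta>)) * (\<kappa> * exp \<tau>) \<le> 24 * pi * norm (\<gamma> \<tau> - k)"
      unfolding \<gamma>_def using \<kappa> k by (intro norm_deriv_Psi_le) (auto simp: mult_le_cancel_right1)
    also have "\<dots> \<le> 24 * pi * \<delta>" using k by (intro mult_left_mono) auto
    finally have "\<kappa> * (exp \<tau> * norm (deriv Psi (Complex (exp \<tau>) \<theta>))) \<le> 24 * pi * \<delta>" by (simp add: mult_ac)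
    then show ?thesis using \<kappa> unfolding C \<kappa>_def[symmetric] by (simp add: norm_mult field_simps)
  qed
  have "norm (\<gamma> \<beta> - \<gamma> \<alpha>) \<le> C * \<delta> * norm (\<beta> - \<alpha>)"
  proof (rule differentiable_bound[of "{\<alpha>..\<beta>}" \<gamma> "\<lambda>\<tau> t. t *\<^sub>R (of_real (exp \<tau>) * deriv Psi (Complex (exp \<tau>) \<theta>))"])
    show "onorm (\<lambda>t. t *\<^sub>R (of_real (exp \<tau>) * deriv Psi (Complex (exp \<tau>) \<theta>))) \<le> C * \<delta>" if "\<tau> \<in> {\<alpha>..\<beta>}" for \<tau>
    proof (rule onorm_le)
      fix t :: real
      show "norm (t *\<^sub>R (of_real (exp \<tau>) * deriv Psi (Complex (exp \<tau>) \<theta>))) \<le> C * \<delta> * norm t"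
        using mult_left_mono[OF bound[OF that], of "\<bar>t\<bar>"] by (simp add: mult.commute)
    qed
  qed (use der \<tau>(1) in \<open>auto simp: has_vector_derivative_def\<close>)
  also have "\<dots> \<le> C * \<delta> * A" using \<tau> C0 \<rho> by (intro mult_left_mono) (auto simp: \<delta>_def)
  also have "\<dots> = (\<rho>2 - \<rho>1) / 2" using C0 \<tau>(4) by (simp add: \<delta>_def field_simps)
  finally have "norm (\<gamma> \<beta> - \<gamma> \<alpha>) \<le> (\<rho>2 - \<rho>1) / 2" .
  moreover have "\<rho>2 - \<rho>1 \<le> norm (\<gamma> \<beta> - \<gamma> \<alpha>)"
    using norm_triangle_ineq2[of "\<gamma> \<beta> - y" "\<gamma> \<alpha> - y"] \<rho> by (simp add: \<gamma>_def)
  ultimately show False using \<rho>(3) by simp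
qed

end

context boettcher_unicritical
begin

section \<open>Backward orbits under a contracting inverse branch\<close>

context
  fixes y P :: complex and r \<mu> :: real and h :: "complex \<Rightarrow> complex" and p :: nat
  assumes y: "y \<in> K" and \<mu>: "\<mu> > 1" and p: "p \<ge> 1"
    and hol_h: "h holomorphic_on ball y r"
    and h_ball: "\<And>z. z \<in> ball y r \<Longrightarrow> h z \<in> ball y r"
    and f_h: "\<And>z. z \<in> ball y r \<Longrightarrow> (f ^^ p) (h z) = z"
    and h_contr: "\<And>z. z \<in> ball y r \<Longrightarrow> norm (h z - y) \<le> norm (z - y) / \<mu>"
    and P: "P \<in> ball y r" "P \<notin> K"
begin

lemma h_iter_ball: "z \<in> ball y r \<Longrightarrow> (h ^^ n) z \<in> ball y r"
  by (induction n) (use h_ball in auto)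

lemma h_iter_contr: "z \<in> ball y r \<Longrightarrow> norm ((h ^^ n) z - y) \<le> norm (z - y) / \<mu> ^ n"
proof (induction n)
  case (Suc n)
  have "norm ((h ^^ Suc n) z - y) \<le> norm ((h ^^ n) z - y) / \<mu>"
    using h_contr[OF h_iter_ball[OF Suc.prems]] by simp
  also have "\<dots> \<le> norm (z - y) / \<mu> ^ n / \<mu>" using Suc \<mu> by (intro divide_right_mono) auto
  finally show ?case by (simp add: mult.commute)
qed simp

lemma f_iter_h_iter: "z \<in> ball y r \<Longrightarrow> (f ^^ (p * n)) ((h ^^ n) z) = z"
proof (induction n)
  case (Suc n)
  have "(f ^^ (p * Suc n)) ((h ^^ Suc n) z) = (f ^^ (p * n)) ((f ^^ p) (h ((h ^^ n) z)))"
    by (simp add: add.commute[of p] funpow_add)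
  then show ?case using Suc f_h[OF h_iter_ball[OF Suc.prems]] by simp
qed simp

lemma h_iter_notin_K: "z \<in> ball y r \<Longrightarrow> z \<notin> K \<Longrightarrow> (h ^^ n) z \<notin> K"
  using f_iter_h_iter iter_in_K_iff by metis

text \<open>Rays outwards from the points \<open>(h ^^ i) P\<close> cross about \<open>i\<close> annuli around \<open>y\<close> in logarithmic
  potential time \<open>i ln (D ^ p) + O(1)\<close>. A quick crossing leaves a comparatively large disc inside the
  component of the ray, so in each annulus only boundedly many components admit one.\<close>

lemma inverse_orbit_same_component:
  obtains i j where "i < j" "connected_component (ball y r - K) ((h ^^ i) P) ((h ^^ j) P)"
proof (rule ccontr)
  assume "\<not> thesis"
  with that have less: "i < j \<Longrightarrow> \<not> connected_component (ball y r - K) ((h ^^ i) P) ((h ^^ j) P)" for i j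
    by blast
  have sep: "\<not> connected_component (ball y r - K) ((h ^^ i) P) ((h ^^ j) P)" if "i \<noteq> j" for i j
    using that less[of i j] less[of j i] connected_component_sym linorder_neqE_nat by blast
  define a where "a i = (h ^^ i) P" for i
  have a: "a i \<in> ball y r" "a i \<notin> K" for i
    using h_iter_ball h_iter_notin_K P by (auto simp: a_def)
  define M where "M = real D ^ p"
  have M: "M \<ge> 1" "ln M \<ge> 0" using D_pos by (auto simp: M_def)
  define g0 where "g0 = ln (norm (B P))"
  have g0: "g0 > 0" using norm_B[OF P(2)] by (simp add: g0_def ln_gt_zero)
  have "\<exists>Z. Re Z > 0 \<and> Psi Z = a i" for i by (rule Psi_surj[OF a(2)[of i]]) blast
  then obtain Z where Z: "\<And>i. Re (Z i) > 0" "\<And>i. Psi (Z i) = a i" by metis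
  have ReZ: "Re (Z i) = g0 / M ^ i" for i
  proof -
    have "B P = B ((f ^^ (p * i)) (a i))" using f_iter_h_iter[OF P(1), of i] by (simp add: a_def)
    also have "\<dots> = B (a i) ^ (D ^ (p * i))" by (rule B_iter[OF a(2)])
    also have "\<dots> = exp (Z i) ^ (D ^ (p * i))" using Z B_Psi by metis
    finally have "g0 = ln (exp (Re (Z i)) ^ (D ^ (p * i)))" by (simp add: g0_def norm_power)
    also have "\<dots> = M ^ i * Re (Z i)" by (simp add: ln_realpow M_def power_mult)
    finally show ?thesis using M by (simp add: field_simps)
  qed
  obtain C' where C': "\<And>z. z \<notin> K \<Longrightarrow> norm z \<le> norm y + r \<Longrightarrow> norm (B z) \<le> C'"
    using B_bounded_if_norm_bounded by blast
  define t1 where "t1 = max 1 (ln C')"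
  have t1: "t1 \<ge> 1" by (simp add: t1_def)
  have pot: "Re W \<le> t1" if W: "Re W > 0" "Psi W \<in> ball y r" for W
  proof -
    have "norm (Psi W) \<le> norm y + r"
      using norm_triangle_ineq2[of "Psi W" y] W(2) by (simp add: dist_norm norm_minus_commute)
    then have "exp (Re W) \<le> C'" using C'[OF Psi_notin_K[OF W(1)]] W(1) by (simp add: B_Psi)
    then have "ln (exp (Re W)) \<le> ln C'" by (subst ln_le_cancel_iff) (auto intro: less_le_trans[OF exp_gt_zero])
    then show ?thesis by (simp add: t1_def)
  qed
  define \<gamma> where "\<gamma> i \<tau> = Psi (Complex (exp \<tau>) (Im (Z i)))" for i \<tau>
  define \<sigma> where "\<sigma> i = ln (Re (Z i))" for i
  have \<gamma>\<sigma>: "\<gamma> i (\<sigma> i) = a i" for i using Z by (simp add: \<gamma>_def \<sigma>_def)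
  have \<gamma>_notK: "\<gamma> i \<tau> \<notin> K" for i \<tau> unfolding \<gamma>_def by (rule Psi_notin_K) simp
  have cont: "continuous_on S (\<gamma> i)" for S i unfolding \<gamma>_def
    by (rule continuous_on_compose2[OF continuous_Psi]) (auto intro!: continuous_intros continuous_on_Complex)
  define \<rho> where "\<rho> m = norm (P - y) / \<mu> ^ m" for m :: nat
  have "P \<noteq> y" using y P by auto
  then have \<rho>_pos: "\<rho> m > 0" for m using \<mu> by (simp add: \<rho>_def)
  have \<rho>_Suc: "\<rho> (Suc m) = \<rho> m / \<mu>" for m by (simp add: \<rho>_def)
  have \<rho>_less: "\<rho> (Suc m) < \<rho> m" for m
    using \<rho>_pos[of m] \<mu> unfolding \<rho>_Suc by (simp add: divide_less_eq mult_less_cancel_left1)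
  have \<rho>_mono: "\<rho> n \<le> \<rho> m" if "m \<le> n" for m n
    using that by (rule lift_Suc_antimono_le[rotated]) (use \<rho>_less less_imp_le in blast)
  have \<rho>_r: "\<rho> m < r" for m
    using \<rho>_mono[of 0 m] P(1) by (simp add: \<rho>_def dist_norm norm_minus_commute)
  have \<gamma>_ball: "\<gamma> i \<tau> \<in> ball y r" if "norm (\<gamma> i \<tau> - y) \<le> \<rho> m" for i \<tau> m
    using that \<rho>_r[of m] by (simp add: dist_norm norm_minus_commute)
  \<comment> \<open>The first time at which the ray from \<open>a i\<close> reaches radius
    \<open>\<rho> m\<close>. It exists for \<open>m \<le> i\<close>: the start is within radius
    \<open>\<rho> i\<close>, and potentials in the disc are at most \<open>t1\<close>, so the ray
    has to leave.\<close>
  define exits where "exits i m T \<longleftrightarrow> T \<ge> \<sigma> i \<and> norm (\<gamma> i T - y) = \<rho> m \<and>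
      (\<forall>\<tau>. \<sigma> i \<le> \<tau> \<longrightarrow> \<tau> < T \<longrightarrow> norm (\<gamma> i \<tau> - y) < \<rho> m)" for i m T
  have "\<exists>T. m \<le> i \<longrightarrow> exits i m T" for i m
  proof (cases "m \<le> i")
    case True
    have start: "norm (\<gamma> i (\<sigma> i) - y) \<le> \<rho> m"
      using h_iter_contr[OF P(1), of i] \<rho>_mono[OF True] by (simp add: \<gamma>\<sigma> a_def \<rho>_def)
    define b where "b = max (\<sigma> i) (t1 + 1)"
    have b: "b \<ge> \<sigma> i" by (simp add: b_def)
    have "norm (\<gamma> i b - y) \<ge> \<rho> m"
    proof (rule ccontr)
      assume "\<not> ?thesis"
      then have "exp b \<le> t1" using pot[of "Complex (exp b) (Im (Z i))"] \<gamma>_ball[of i b m] by (simp add: \<gamma>_def)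
      moreover have "exp b \<ge> 1 + b" by (rule exp_ge_add_one_self)
      moreover have "b \<ge> t1 + 1" by (simp add: b_def)
      ultimately show False by linarith
    qed
    note ge = this
    have c: "continuous_on {\<sigma> i..} (\<lambda>\<tau>. norm (\<gamma> i \<tau> - y))" by (intro continuous_intros cont)
    obtain T where "T \<ge> \<sigma> i" "norm (\<gamma> i T - y) = \<rho> m"
      "\<And>\<tau>. \<sigma> i \<le> \<tau> \<Longrightarrow> \<tau> < T \<Longrightarrow> norm (\<gamma> i \<tau> - y) < \<rho> m"
      by (rule first_exit_time[of "\<sigma> i" "\<lambda>\<tau>. norm (\<gamma> i \<tau> - y)" "\<rho> m" b, OF c start b ge]) blast
    then show ?thesis unfolding exits_def by blast
  qed simp
  then have ex: "m \<le> i \<Longrightarrow> \<exists>T. exits i m T" for i m by blast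
  define T where "T i m = (SOME T. exits i m T)" for i m
  have "m \<le> i \<Longrightarrow> exits i m (T i m)" for i m unfolding T_def by (rule someI_ex[OF ex])
  then have T: "\<And>i m. m \<le> i \<Longrightarrow> T i m \<ge> \<sigma> i" "\<And>i m. m \<le> i \<Longrightarrow> norm (\<gamma> i (T i m) - y) = \<rho> m"
      "\<And>i m \<tau>. m \<le> i \<Longrightarrow> \<sigma> i \<le> \<tau> \<Longrightarrow> \<tau> < T i m \<Longrightarrow> norm (\<gamma> i \<tau> - y) < \<rho> m" unfolding exits_def by blast+
  have T_le: "T i (Suc m) \<le> T i m" if "Suc m \<le> i" for i m
    using T(3)[OF that T(1)[of m i]] T(2)[of m i] that \<rho>_less[of m] by fastforce
  have inside: "norm (\<gamma> i \<tau> - y) \<le> \<rho> m" if "m \<le> i" "\<sigma> i \<le> \<tau>" "\<tau> \<le> T i m" for i m \<tau>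
    using T(2)[OF that(1)] T(3)[OF that(1,2)] that(3) by (cases "\<tau> = T i m") auto
  have exp_T: "exp (T i m) \<le> t1" if "m \<le> i" for i m
    using pot[of "Complex (exp (T i m)) (Im (Z i))"] \<gamma>_ball[of i "T i m" m] T(2)[OF that] by (simp add: \<gamma>_def)
  have conn: "connected_component (ball y r - K) (a i) (\<gamma> i \<tau>)" if "m \<le> i" "\<sigma> i \<le> \<tau>" "\<tau> \<le> T i m" for i m \<tau>
    unfolding connected_component_def
  proof (intro exI[of _ "\<gamma> i ` {\<sigma> i..\<tau>}"] conjI)
    show "connected (\<gamma> i ` {\<sigma> i..\<tau>})" by (intro connected_continuous_image cont connected_Icc)
    show "\<gamma> i ` {\<sigma> i..\<tau>} \<subseteq> ball y r - K" using \<gamma>_notK \<gamma>_ball inside[OF that(1)] that by force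
    show "a i \<in> \<gamma> i ` {\<sigma> i..\<tau>}" using \<gamma>\<sigma>[of i] that by (intro image_eqI[of _ _ "\<sigma> i"]) auto
    show "\<gamma> i \<tau> \<in> \<gamma> i ` {\<sigma> i..\<tau>}" using that by auto
  qed
  define C where "C = 24 * pi / min 1 (pi / t1)"
  \<comment> \<open>The threshold between fast and slow crossings. Half of the rays will be slow in
    each annulus; the factor \<open>2\<close> compensates for this, and the summand \<open>2\<close>
    is the surplus for the contradiction.\<close>
  define A where "A = 2 * ln M + 2"
  have C: "C > 0" using t1 by (auto simp: C_def)
  have A: "A > 0" unfolding A_def using M(2) by linarith
  define c0 where "c0 = (1 - 1 / \<mu>) / (2 * C * A)"
  have c0: "c0 > 0" using \<mu> C A by (simp add: c0_def)
  obtain k0 where k0: "\<And>X. X \<subseteq> cball (0::complex) 1 \<Longrightarrow> (\<And>x y. x \<in> X \<Longrightarrow> y \<in> X \<Longrightarrow> x \<noteq> y \<Longrightarrow> dist x y \<ge> c0) \<Longrightarrow> card X \<le> k0"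
    using separated_points_bounded[OF compact_cball c0, of 0 1] by blast
  \<comment> \<open>A fast crossing passes a point at distance at least \<open>c0 * \<rho> m\<close>
    from \<open>K\<close>. Two such points closer than this are joined by a segment off
    \<open>K\<close>, so points from different components are separated. Scaling by
    \<open>\<rho> m\<close> leads to the unit disc and the packing bound.\<close>
  have few: "card {i \<in> I. T i m - T i (Suc m) \<le> A} \<le> k0" if I: "\<And>i. i \<in> I \<Longrightarrow> Suc m \<le> i" for I m
  proof -
    define S where "S = {i \<in> I. T i m - T i (Suc m) \<le> A}"
    have "\<exists>\<tau>\<in>{T i (Suc m)..T i m}. \<forall>k\<in>K. norm (\<gamma> i \<tau> - k) \<ge> c0 * \<rho> m" if "i \<in> S" for i
    proof -
      have i: "Suc m \<le> i" "m \<le> i" "T i m - T i (Suc m) \<le> A" using that I by (auto simp: S_def Suc_leD)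
      have "\<exists>\<tau>\<in>{T i (Suc m)..T i m}. \<forall>k\<in>K. norm (\<gamma> i \<tau> - k) \<ge> (\<rho> m - \<rho> (Suc m)) / (2 * C * A)"
        unfolding \<gamma>_def
        by (rule ray_crossing[OF C_def _ T_le[OF i(1)] exp_T[OF i(2)] i(3) A
              T(2)[OF i(1), unfolded \<gamma>_def] T(2)[OF i(2), unfolded \<gamma>_def] \<rho>_less]) (use t1 in simp)
      moreover have "(\<rho> m - \<rho> (Suc m)) / (2 * C * A) = c0 * \<rho> m"
        unfolding \<rho>_Suc c0_def by (simp add: left_diff_distrib)
      ultimately show ?thesis by simp
    qed
    then obtain \<tau> where \<tau>: "\<And>i. i \<in> S \<Longrightarrow> \<tau> i \<in> {T i (Suc m)..T i m}"
        "\<And>i k. i \<in> S \<Longrightarrow> k \<in> K \<Longrightarrow> norm (\<gamma> i (\<tau> i) - k) \<ge> c0 * \<rho> m" by metis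
    define w where "w i = \<gamma> i (\<tau> i)" for i
    have w: "norm (w i - y) \<le> \<rho> m" "connected_component (ball y r - K) (a i) (w i)" if "i \<in> S" for i
    proof -
      have "m \<le> i" "\<sigma> i \<le> \<tau> i" "\<tau> i \<le> T i m"
        using that I T(1)[of "Suc m" i] \<tau>(1)[OF that] by (auto simp: S_def Suc_leD intro: order_trans)
      then show "norm (w i - y) \<le> \<rho> m" "connected_component (ball y r - K) (a i) (w i)"
        unfolding w_def by (rule inside, rule conn)
    qed
    have far: "norm (w i - w j) \<ge> c0 * \<rho> m" if ij: "i \<in> S" "j \<in> S" "i \<noteq> j" for i j
    proof (rule ccontr)
      assume *: "\<not> ?thesis"
      have "closed_segment (w i) (w j) \<subseteq> ball y r"
        using w(1)[OF ij(1)] w(1)[OF ij(2)] \<rho>_r[of m]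
        by (intro closed_segment_subset) (auto simp: dist_norm norm_minus_commute)
      moreover have "v \<notin> K" if "v \<in> closed_segment (w i) (w j)" for v
      proof
        assume "v \<in> K"
        then have "c0 * \<rho> m \<le> norm (w i - v)" using \<tau>(2)[OF ij(1)] by (simp add: w_def)
        also have "\<dots> \<le> norm (w i - w j)" using segment_bound1[OF that] by (simp add: norm_minus_commute)
        finally show False using * by simp
      qed
      ultimately have "connected_component (ball y r - K) (w i) (w j)"
        unfolding connected_component_def by (intro exI[of _ "closed_segment (w i) (w j)"]) auto
      then have "connected_component (ball y r - K) (a i) (a j)"
        using w(2)[OF ij(1)] w(2)[OF ij(2)] by (meson connected_component_sym connected_component_trans)
      then show False using sep[OF ij(3)] by (simp add: a_def)
    qed
    define x where "x i = (w i - y) / of_real (\<rho> m)" for i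
    have dist_x: "dist (x i) (x j) = norm (w i - w j) / \<rho> m" for i j
      using \<rho>_pos[of m] by (simp add: x_def dist_norm diff_divide_distrib[symmetric] norm_divide)
    have far_x: "dist (x i) (x j) \<ge> c0" if "i \<in> S" "j \<in> S" "i \<noteq> j" for i j
      unfolding dist_x using far[OF that] \<rho>_pos[of m] by (simp add: le_divide_eq)
    have "inj_on x S" using far_x c0 by (auto simp: inj_on_def) (metis dist_self not_less)
    then have "card S = card (x ` S)" by (simp add: card_image)
    also have "\<dots> \<le> k0"
    proof (rule k0)
      show "x ` S \<subseteq> cball 0 1"
        using w(1) \<rho>_pos[of m] by (auto simp: x_def norm_divide divide_le_eq)
    qed (use far_x in auto)
    finally show ?thesis by (simp add: S_def)
  qed
  \<comment> \<open>Of \<open>k\<close> rays at most \<open>k0\<close> are fast in an annulus, so at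
    least half of them are slow. Indices from \<open>N\<close> on make all of them cross the first
    \<open>N\<close> annuli.\<close>
  define k where "k = 2 * (k0 + 1)"
  define c1 where "c1 = ln t1 - ln g0 + k * ln M"
  obtain N :: nat where N: "real N > c1" using reals_Archimedean2 by blast
  define I where "I = {N..<N + k}"
  have card_I: "card I = k" "finite I" by (auto simp: I_def)
  define x where "x i m = T i m - T i (Suc m)" for i m
  have lower: "(k0 + 1) * A \<le> (\<Sum>i\<in>I. x i m)" if m: "m < N" for m
  proof -
    define S where "S = {i \<in> I. x i m \<le> A}"
    have "card S \<le> k0" unfolding S_def x_def by (rule few) (use m in \<open>auto simp: I_def\<close>)
    then have "k0 + 1 \<le> card (I - S)"
      using card_I by (subst card_Diff_subset) (auto simp: S_def k_def)
    then have "(k0 + 1) * A \<le> (\<Sum>i\<in>I - S. A)" using A by simp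
    also have "\<dots> \<le> (\<Sum>i\<in>I - S. x i m)" by (intro sum_mono) (auto simp: S_def)
    also have "\<dots> \<le> (\<Sum>i\<in>I. x i m)"
      using card_I T_le m by (intro sum_mono2) (auto simp: x_def I_def)
    finally show ?thesis .
  qed
  \<comment> \<open>The total crossing time is counted by annuli and by rays. A ray has only the
    time from potential \<open>g0 / M ^ i\<close> to \<open>t1\<close>, at most
    \<open>c1 + N * ln M\<close>, and the two counts disagree once \<open>N > c1\<close>.\<close>
  have "N * ((k0 + 1) * A) = (\<Sum>m<N. (k0 + 1) * A)" by simp
  also have "\<dots> \<le> (\<Sum>m<N. \<Sum>i\<in>I. x i m)" by (intro sum_mono lower) auto
  also have "\<dots> = (\<Sum>i\<in>I. \<Sum>m<N. x i m)" by (rule sum.swap)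
  also have "\<dots> \<le> (\<Sum>i\<in>I. c1 + N * ln M)"
  proof (rule sum_mono)
    fix i assume i: "i \<in> I"
    have "(\<Sum>m<N. x i m) = T i 0 - T i N" unfolding x_def by (rule sum_lessThan_telescope')
    also have "\<dots> \<le> ln t1 - \<sigma> i"
    proof -
      have "T i 0 \<le> ln t1" using exp_T[of 0 i] t1 by (simp add: ln_ge_iff)
      moreover have "T i N \<ge> \<sigma> i" using i by (intro T) (auto simp: I_def)
      ultimately show ?thesis by simp
    qed
    also have "\<sigma> i = ln g0 - i * ln M"
      unfolding \<sigma>_def ReZ using g0 M by (simp add: ln_div ln_realpow)
    also have "ln t1 - (ln g0 - i * ln M) \<le> c1 + N * ln M"
    proof -
      have "real i * ln M \<le> (real N + real k) * ln M"
        using i M by (intro mult_right_mono) (auto simp: I_def)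
      then show ?thesis by (simp add: c1_def distrib_right)
    qed
    finally show "(\<Sum>m<N. x i m) \<le> c1 + N * ln M" .
  qed
  also have "\<dots> = 2 * (k0 + 1) * (c1 + N * ln M)" by (simp add: card_I k_def)
  finally have "(k0 + 1) * (N * A) \<le> (k0 + 1) * (2 * (c1 + N * ln M))" by (simp add: algebra_simps)
  then have "N * A \<le> 2 * (c1 + N * ln M)" by (subst (asm) mult_le_cancel_left_pos) auto
  then show False using N by (simp add: A_def algebra_simps)
qed

text \<open>The inverse branch lifts to an affine contraction of the half-plane towards a boundary
  point \<open>Zs\<close>. It preserves the horizontal line through \<open>Zs\<close>, so
  convergence of \<open>Psi (L n Z)\<close> to \<open>y\<close> on one open set spreads by normality
  to this line, which is a ray of periodic angle.\<close>

lemma periodic_ray_lands: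
  obtains s q j where "q \<ge> 1" "lands s y" "real D ^ (p * q) * s = s + of_int j"
proof -
  obtain i i' where ii: "i < i'" "connected_component (ball y r - K) ((h ^^ i) P) ((h ^^ i') P)"
    by (rule inverse_orbit_same_component)
  define q where "q = i' - i"
  define Q where "Q = (h ^^ i) P"
  define H where "H = h ^^ q"
  define N where "N = D ^ (p * q)"
  have q: "q \<ge> 1" using ii by (simp add: q_def)
  have Q: "Q \<in> ball y r" "Q \<notin> K" using h_iter_ball h_iter_notin_K P by (auto simp: Q_def)
  have HQ: "(h ^^ i') P = H Q" using ii by (simp add: H_def Q_def q_def funpow_add[symmetric, THEN fun_cong, unfolded o_def])
  have N: "real N \<ge> 2"
  proof -
    have "D ^ 1 \<le> D ^ (p * q)" using D_pos p q by (intro power_increasing) auto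
    then have "2 \<le> N" using D_ge_2 by (simp add: N_def)
    then show ?thesis by simp
  qed
  have H_ball: "H z \<in> ball y r" if "z \<in> ball y r" for z using h_iter_ball[OF that] by (simp add: H_def)
  have f_H: "(f ^^ (p * q)) (H z) = z" if "z \<in> ball y r" for z using f_iter_h_iter[OF that] by (simp add: H_def)
  have hol_H: "H holomorphic_on ball y r" unfolding H_def
  proof (induction q)
    case 0
    show ?case by (simp add: holomorphic_on_id id_def[symmetric])
  next
    case (Suc n)
    have "h \<circ> (h ^^ n) holomorphic_on ball y r"
      using Suc hol_h h_iter_ball by (intro holomorphic_on_compose_gen[of _ _ _ "ball y r"]) auto
    then show ?case by (simp add: o_def)
  qed
  have "open (ball y r - K)" using closed_K by (intro open_Diff) auto
  then have "path_component (ball y r - K) Q (H Q)"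
    using ii(2) path_component_eq_connected_component open_imp_locally_path_connected
    unfolding HQ Q_def[symmetric] by metis
  then obtain g where g: "path g" "path_image g \<subseteq> ball y r - K" "pathstart g = Q" "pathfinish g = H Q"
    by (auto simp: path_component_def)
  have g_in: "g t \<in> ball y r" "g t \<notin> K" if "t \<in> {0..1}" for t
  proof -
    have "g t \<in> ball y r - K" using g(2) that unfolding path_image_def by blast
    then show "g t \<in> ball y r" "g t \<notin> K" by auto
  qed
  have "continuous_on {0..1} (\<lambda>t. B (g t))"
    by (rule continuous_on_compose2[OF continuous_B g(1)[unfolded path_def]]) (use g_in in auto)
  moreover have "B (g t) \<noteq> 0" if "t \<in> {0..1}" for t using norm_B[OF g_in(2)[OF that]] by auto
  ultimately obtain l where l: "continuous_on {0..1} l" "\<And>t. t \<in> {0..1} \<Longrightarrow> B (g t) = exp (l t)"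
    using continuous_logarithm_on_contractible[of "{0..1::real}" "\<lambda>t. B (g t)"] convex_imp_contractible
    by (metis convex_real_interval(5))
  have l_pos: "Re (l t) > 0" if "t \<in> {0..1}" for t
    using norm_B[OF g_in(2)[OF that]] l(2)[OF that] by simp
  have Psi_l: "Psi (l t) = g t" if "t \<in> {0..1}" for t
    unfolding Psi_def l(2)[OF that, symmetric] by (rule Bi_B[OF g_in(2)[OF that]])
  define Z0 Z1 where "Z0 = l 0" and "Z1 = l 1"
  have Z: "Re Z0 > 0" "Re Z1 > 0" "Psi Z0 = Q" "Psi Z1 = H Q"
    using l_pos Psi_l g(3,4) by (auto simp: Z0_def Z1_def pathstart_def pathfinish_def)
  have "B Q = B (H Q) ^ N"
    using B_iter[of "H Q" "p * q"] f_H[OF Q(1)] Psi_notin_K[OF Z(2)] Z(4) by (simp add: N_def)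
  \<comment> \<open>\<open>of_nat N * Z1\<close> and \<open>Z0\<close> lie over the same point, so
    they differ by a period. The integer \<open>m\<close> belongs to the chosen path and determines
    the angle found at the end.\<close>
  then have "exp Z0 = exp (of_nat N * Z1)"
    using Z B_Psi by (metis exp_of_nat_mult)
  then obtain m :: int where m: "of_nat N * Z1 = Z0 + of_real (of_int (2 * m) * pi) * \<i>"
    using exp_eq[of "of_nat N * Z1" Z0] by auto
  \<comment> \<open>The fixed point of \<open>Z \<mapsto> (Z + 2 * pi * \<i> * m) / N\<close>;
    \<open>L n\<close> is the closed form of the iterates of this map.\<close>
  define Zs where "Zs = of_real (of_int (2 * m) * pi / (real N - 1)) * \<i>"
  have Zs: "Zs * (of_nat N - 1) = of_real (of_int (2 * m) * pi) * \<i>"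
    using N by (simp add: Zs_def)
  define L where "L n Z = Zs + (Z - Zs) / of_nat N ^ n" for n :: nat and Z
  have N0: "complex_of_nat N \<noteq> 0" using N by auto
  have Re_L: "Re (L n Z) = Re Z / real N ^ n" for n Z
  proof -
    have "L n Z = Zs + (Z - Zs) / of_real (real N ^ n)" by (simp add: L_def)
    then show ?thesis by (simp add: Zs_def Re_divide_of_real)
  qed
  have L_Suc: "L (Suc n) Z = L 1 (L n Z)" for n Z
    using N0 by (simp add: L_def field_simps)
  have L_N: "of_nat N * L 1 Z = Z + of_real (of_int (2 * m) * pi) * \<i>" for Z
    using N0 Zs by (simp add: L_def field_simps)
  have L_Z0: "L 1 Z0 = Z1"
  proof -
    have "of_nat N * L 1 Z0 = of_nat N * Z1" unfolding L_N m ..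
    then show ?thesis using N0 by simp
  qed
  have exp_L: "exp (of_nat N * L 1 Z) = exp Z" for Z
    unfolding L_N exp_eq by blast
  have cont_L: "continuous_on S (L n)" for S n unfolding L_def using N0 by (intro continuous_intros) auto
  have hol_L: "L n holomorphic_on S" for S n unfolding L_def using N0 by (intro holomorphic_intros) auto
  define \<Omega> where "\<Omega> = {Z. Re Z > 0} \<inter> Psi -` ball y r"
  have "open \<Omega>" unfolding \<Omega>_def
    by (rule continuous_open_preimage[OF continuous_Psi open_right_half open_ball])
  define W where "W = connected_component_set \<Omega> Z0"
  have W: "open W" "connected W" "W \<subseteq> \<Omega>"
    unfolding W_def using \<open>open \<Omega>\<close> by (simp_all add: open_connected_component connected_component_subset)
  have Z0: "Z0 \<in> W" unfolding W_def using Z Q by (simp add: \<Omega>_def)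
  have Z1: "Z1 \<in> W"
  proof -
    have "l ` {0..1} \<subseteq> \<Omega>" using l_pos Psi_l g_in by (auto simp: \<Omega>_def)
    moreover have "connected (l ` {0..1})" by (intro connected_continuous_image l connected_Icc)
    ultimately show ?thesis unfolding W_def mem_Collect_eq connected_component_def Z0_def Z1_def by force
  qed
  have \<Omega>: "Re Z > 0" "Psi Z \<in> ball y r" if "Z \<in> \<Omega>" for Z using that by (auto simp: \<Omega>_def)
  have f_Psi_L: "(f ^^ (p * q)) (Psi (L 1 Z)) = Psi Z" if "Re Z > 0" for Z
  proof -
    have pos: "Re (L 1 Z) > 0" using that N by (simp add: Re_L)
    have "(f ^^ (p * q)) (Psi (L 1 Z)) = Psi (of_nat N * L 1 Z)" unfolding N_def by (rule iter_Psi[OF pos])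
    also have "\<dots> = Psi Z" unfolding Psi_def exp_L ..
    finally show ?thesis .
  qed
  have hol_Psi_L: "(\<lambda>Z. Psi (L n Z)) holomorphic_on {Z. Re Z > 0}" for n
  proof -
    have "Psi \<circ> L n holomorphic_on {Z. Re Z > 0}"
      by (rule holomorphic_on_compose_gen[OF hol_L holomorphic_Psi]) (use N in \<open>auto simp: Re_L\<close>)
    then show ?thesis by (simp add: o_def)
  qed
  have hol_H_Psi: "(\<lambda>Z. H (Psi Z)) holomorphic_on \<Omega>"
  proof -
    have "H \<circ> Psi holomorphic_on \<Omega>"
      by (rule holomorphic_on_compose_gen[OF holomorphic_on_subset[OF holomorphic_Psi] hol_H]) (auto simp: \<Omega>_def)
    then show ?thesis by (simp add: o_def)
  qed
  have eq: "Psi (L 1 Z) = H (Psi Z)" if "Z \<in> W" for Z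
  proof -
    \<comment> \<open>By the chain rule the iterate of \<open>f\<close> has nonzero derivative at
      \<open>H Q\<close> and is injective nearby. Hence its two lifts agree near \<open>Z0\<close>,
      and then on \<open>W\<close> by the identity theorem.\<close>
    have "((f ^^ (p * q)) \<circ> H has_field_derivative deriv (f ^^ (p * q)) (H Q) * deriv H Q) (at Q)"
      using holomorphic_derivI[OF holomorphic_iter open_UNIV, of "H Q"] holomorphic_derivI[OF hol_H open_ball Q(1)]
      by (intro DERIV_chain) auto
    moreover have "((f ^^ (p * q)) \<circ> H has_field_derivative 1) (at Q)"
      by (rule has_field_derivative_transform_within_open[OF DERIV_ident open_ball Q(1)]) (simp add: f_H)
    ultimately have "deriv (f ^^ (p * q)) (H Q) * deriv H Q = 1" by (rule DERIV_unique)
    then have "deriv (f ^^ (p * q)) (H Q) \<noteq> 0" by auto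
    then obtain s where s: "s > 0" "inj_on (f ^^ (p * q)) (ball (H Q) s)"
      using has_complex_derivative_locally_injective[OF holomorphic_iter UNIV_I open_UNIV] by metis
    define U where "U = (W \<inter> (\<lambda>Z. Psi (L 1 Z)) -` ball (H Q) s) \<inter> (W \<inter> (\<lambda>Z. H (Psi Z)) -` ball (H Q) s)"
    have "W \<subseteq> {Z. Re Z > 0}" using W(3) \<Omega> by blast
    then have hol_W: "(\<lambda>Z. Psi (L 1 Z)) holomorphic_on W" "(\<lambda>Z. H (Psi Z)) holomorphic_on W"
      using holomorphic_on_subset hol_Psi_L hol_H_Psi W(3) by blast+
    then have "open U" unfolding U_def
      using W(1) by (intro open_Int continuous_open_preimage holomorphic_on_imp_continuous_on) auto
    moreover have "Z0 \<in> U" using Z0 L_Z0 Z s(1) by (simp add: U_def)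
    moreover have "U \<subseteq> W" by (auto simp: U_def)
    moreover have "Psi (L 1 Z) = H (Psi Z)" if "Z \<in> U" for Z
    proof (rule inj_onD[OF s(2)])
      have "Z \<in> \<Omega>" using that W(3) by (auto simp: U_def)
      then show "(f ^^ (p * q)) (Psi (L 1 Z)) = (f ^^ (p * q)) (H (Psi Z))"
        using f_Psi_L f_H \<Omega> by simp
    qed (use that in \<open>auto simp: U_def\<close>)
    ultimately show ?thesis
      using analytic_continuation_open[of U W "\<lambda>Z. Psi (L 1 Z)" "\<lambda>Z. H (Psi Z)" Z] W hol_W that by blast
  qed
  have L_W: "L 1 Z \<in> W" if "Z \<in> W" for Z
  proof -
    have "L 1 ` W \<subseteq> \<Omega>"
    proof
      fix v assume "v \<in> L 1 ` W"
      then obtain Z where "Z \<in> W" "v = L 1 Z" by blast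
      then show "v \<in> \<Omega>" using eq[of Z] H_ball \<Omega>[of Z] W(3) N by (auto simp: \<Omega>_def Re_L)
    qed
    moreover have "connected (L 1 ` W)" by (intro connected_continuous_image cont_L W)
    moreover have "Z1 \<in> L 1 ` W" using Z0 L_Z0 by force
    ultimately have "L 1 ` W \<subseteq> connected_component_set \<Omega> Z1" by (intro connected_component_maximal)
    also have "\<dots> = W" using Z1 unfolding W_def by (metis connected_component_eq)
    finally show ?thesis using that by blast
  qed
  have iter_W: "L n Z \<in> W \<and> Psi (L n Z) = (H ^^ n) (Psi Z)" if "Z \<in> W" for n Z
  proof (induction n)
    case 0
    have "L 0 Z = Z" by (simp add: L_def)
    then show ?case using that by simp
  next
    case (Suc n)
    then have "L n Z \<in> W" "Psi (L n Z) = (H ^^ n) (Psi Z)" by auto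
    then show ?case
      using L_W[of "L n Z"] eq[of "L n Z"] by (simp only: L_Suc[of n] funpow.simps o_apply simp_thms)
  qed
  have lim_W: "(\<lambda>n. Psi (L n Z)) \<longlonglongrightarrow> y" if "Z \<in> W" for Z
  proof -
    have in_ball: "Psi Z \<in> ball y r" using that W(3) \<Omega> by blast
    have bound: "norm (Psi (L n Z) - y) \<le> norm (Psi Z - y) * (1 / \<mu> ^ q) ^ n" for n
    proof -
      have "(H ^^ n) (Psi Z) = (h ^^ (q * n)) (Psi Z)" by (simp add: H_def funpow_mult mult.commute)
      then have "Psi (L n Z) = (h ^^ (q * n)) (Psi Z)" using iter_W[OF that] by metis
      moreover have "norm (Psi Z - y) / \<mu> ^ (q * n) = norm (Psi Z - y) * (1 / \<mu> ^ q) ^ n"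
        by (simp add: power_mult power_divide)
      ultimately show ?thesis using h_iter_contr[OF in_ball, of "q * n"] by metis
    qed
    have "1 < \<mu> ^ q" using \<mu> q by (intro one_less_power) auto
    then have "(\<lambda>n. norm (Psi Z - y) * (1 / \<mu> ^ q) ^ n) \<longlonglongrightarrow> norm (Psi Z - y) * 0"
      using \<mu> by (intro tendsto_intros LIMSEQ_realpow_zero) auto
    then have lim: "(\<lambda>n. norm (Psi Z - y) * (1 / \<mu> ^ q) ^ n) \<longlonglongrightarrow> 0" unfolding mult_zero_right .
    have "(\<lambda>n. Psi (L n Z) - y) \<longlonglongrightarrow> 0"
      by (rule Lim_null_comparison[OF _ lim]) (intro always_eventually allI bound)
    then show ?thesis by (simp add: LIM_zero_iff)
  qed
  \<comment> \<open>A fundamental segment for \<open>L 1\<close> on the ray of \<open>Zs\<close>: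
    every potential below \<open>1\<close> is of the form \<open>t / N ^ n\<close> with
    \<open>t\<close> in \<open>{1..real N}\<close>.\<close>
  define S where "S = (\<lambda>t. Complex t (Im Zs)) ` {1..real N}"
  have S: "compact S" "S \<subseteq> {Z. Re Z > 0}" unfolding S_def
    by (auto intro!: compact_continuous_image continuous_intros continuous_on_Complex)
  have unif: "\<exists>n0. \<forall>n\<ge>n0. \<forall>Z\<in>S. dist (Psi (L n Z)) y < e" if e: "e > 0" for e
  proof (rule ccontr)
    assume "\<not> ?thesis"
    then have "\<forall>n0. \<exists>n Z. n \<ge> n0 \<and> Z \<in> S \<and> dist (Psi (L n Z)) y \<ge> e" by (meson not_less)
    then obtain \<phi> V where \<phi>: "\<And>n. \<phi> n \<ge> n" "\<And>n. V n \<in> S" "\<And>n. dist (Psi (L (\<phi> n) (V n))) y \<ge> e" by metis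
    \<comment> \<open>The potentials of \<open>L n Z\<close> are bounded on compact sets, so the
      family is normal. A limit along the offending exponents is \<open>y\<close> on
      \<open>W\<close>, hence everywhere, and uniform convergence on \<open>S\<close> contradicts
      the choice of \<open>V\<close>.\<close>
    define \<H> where "\<H> = range (\<lambda>n Z. Psi (L n Z))"
    have bdd: "\<exists>b. \<forall>u\<in>\<H>. \<forall>Z\<in>C. norm (u Z) \<le> b" if C: "compact C" "C \<subseteq> {Z. Re Z > 0}" for C
    proof -
      obtain b where b: "\<And>Z. Z \<in> C \<Longrightarrow> norm Z \<le> b" using compact_imp_bounded[OF C(1)] by (auto simp: bounded_iff)
      obtain b' where b': "\<And>z. z \<notin> K \<Longrightarrow> norm (B z) \<le> exp b \<Longrightarrow> norm z \<le> b'"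
        using norm_bounded_if_B_bounded by blast
      have "norm (Psi (L n Z)) \<le> b'" if ZC: "Z \<in> C" for n Z
      proof -
        have pos: "Re Z > 0" using ZC C by blast
        have "1 \<le> real N ^ n" using N by simp
        then have "Re (L n Z) \<le> Re Z" using pos by (simp add: Re_L divide_le_eq mult_le_cancel_left1)
        also have "\<dots> \<le> b" using b[OF ZC] complex_Re_le_cmod order_trans by blast
        finally have "Re (L n Z) \<le> b" .
        moreover have "Re (L n Z) > 0" using pos N by (simp add: Re_L)
        ultimately show ?thesis by (intro b' Psi_notin_K) (auto simp: B_Psi)
      qed
      then show ?thesis by (auto simp: \<H>_def)
    qed
    have hol: "u holomorphic_on {Z. Re Z > 0}" if "u \<in> \<H>" for u
      using that hol_Psi_L by (auto simp: \<H>_def)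
    have rng: "range (\<lambda>n Z. Psi (L (\<phi> n) Z)) \<subseteq> \<H>" by (auto simp: \<H>_def)
    obtain G \<rho> where G: "G holomorphic_on {Z. Re Z > 0}" "strict_mono (\<rho> :: nat \<Rightarrow> nat)"
        "\<And>Z. Z \<in> {Z. Re Z > 0} \<Longrightarrow> (\<lambda>n. Psi (L (\<phi> (\<rho> n)) Z)) \<longlonglongrightarrow> G Z"
        "\<And>C. compact C \<Longrightarrow> C \<subseteq> {Z. Re Z > 0} \<Longrightarrow> uniform_limit C ((\<lambda>n Z. Psi (L (\<phi> n) Z)) \<circ> \<rho>) G sequentially"
      by (rule Montel[OF open_right_half hol bdd rng]) blast+
    have sub: "filterlim (\<lambda>n. \<phi> (\<rho> n)) at_top sequentially"
    proof (rule filterlim_at_top_mono[OF filterlim_ident])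
      show "eventually (\<lambda>n. n \<le> \<phi> (\<rho> n)) sequentially"
        using \<phi>(1) seq_suble[OF G(2)] order_trans by (intro always_eventually allI) blast
    qed
    have "G Z = y" if "Z \<in> W" for Z
    proof (rule LIMSEQ_unique)
      show "(\<lambda>n. Psi (L (\<phi> (\<rho> n)) Z)) \<longlonglongrightarrow> G Z" using G(3) that W(3) \<Omega> by blast
      show "(\<lambda>n. Psi (L (\<phi> (\<rho> n)) Z)) \<longlonglongrightarrow> y" by (rule filterlim_compose[OF lim_W[OF that] sub])
    qed
    moreover have "connected {Z. Re Z > 0}" using convex_halfspace_Re_gt[of 0] by (intro convex_connected) simp
    moreover have "W \<subseteq> {Z. Re Z > 0}" using W(3) \<Omega> by blast
    ultimately have Gy: "G Z = y" if "Re Z > 0" for Z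
      using analytic_continuation_open[of W "{Z. Re Z > 0}" G "\<lambda>_. y" Z] W Z0 open_right_half G(1) that by auto
    have "eventually (\<lambda>n. \<forall>Z\<in>S. dist (Psi (L (\<phi> (\<rho> n)) Z)) (G Z) < e) sequentially"
      using G(4)[OF S] e unfolding uniform_limit_iff o_def by blast
    then obtain n where "\<forall>Z\<in>S. dist (Psi (L (\<phi> (\<rho> n)) Z)) (G Z) < e"
      by (auto simp: eventually_sequentially)
    then have "dist (Psi (L (\<phi> (\<rho> n)) (V (\<rho> n)))) y < e" using \<phi>(2) S(2) Gy by fastforce
    then show False using \<phi>(3)[of "\<rho> n"] by simp
  qed
  define s where "s = Im Zs / (2 * pi)"
  have "lands s y" unfolding lands_def tendsto_iff
  proof (intro allI impI)
    fix e :: real assume "e > 0"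
    then obtain n0 where n0: "\<And>n Z. n \<ge> n0 \<Longrightarrow> Z \<in> S \<Longrightarrow> dist (Psi (L n Z)) y < e" using unif by blast
    show "eventually (\<lambda>t. dist (Psi (Complex t (2 * pi * s))) y < e) (at_right 0)"
      unfolding eventually_at_right_field
    proof (intro exI conjI allI impI)
      show "1 / real N ^ n0 > 0" using N by simp
      fix t :: real assume t: "0 < t" "t < 1 / real N ^ n0"
      obtain n' where n': "1 / t < real N ^ n'" using real_arch_pow[of "real N" "1 / t"] N by auto
      define n where "n = (LEAST n. 1 \<le> t * real N ^ n)"
      have "1 \<le> t * real N ^ n'" using n' t by (simp add: field_simps)
      then have n: "1 \<le> t * real N ^ n" unfolding n_def by (rule LeastI)
      have less: "t * real N ^ k < 1" if "k < n" for k
        using not_less_Least[OF that[unfolded n_def]] by (simp only: not_le)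
      have "n0 < n"
      proof (rule ccontr)
        assume "\<not> ?thesis"
        then have "real N ^ n \<le> real N ^ n0" using N by (intro power_increasing) auto
        then have "t * real N ^ n \<le> t * real N ^ n0" using t by (intro mult_left_mono) auto
        moreover have "t * real N ^ n0 < 1" using t N by (simp add: field_simps)
        ultimately show False using n by linarith
      qed
      then obtain k where k: "n = Suc k" by (cases n) auto
      have "t * real N ^ n \<le> real N" using less[of k] k N by (simp add: mult.left_commute mult_le_cancel_left1)
      then have in_S: "Complex (t * real N ^ n) (Im Zs) \<in> S" using n by (auto simp: S_def)
      have "Complex (t * real N ^ n) (Im Zs) - Zs = of_real (t * real N ^ n)"
        by (simp add: complex_eq_iff Zs_def)
      then have "L n (Complex (t * real N ^ n) (Im Zs)) = Zs + of_real t"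
        using N by (simp add: L_def)
      also have "\<dots> = Complex t (2 * pi * s)" by (simp add: complex_eq_iff Zs_def s_def)
      finally show "dist (Psi (Complex t (2 * pi * s))) y < e"
        using n0[OF _ in_S, of n] \<open>n0 < n\<close> by simp
    qed
  qed
  moreover have "real D ^ (p * q) * s = s + of_int m"
  proof -
    have "(real N - 1) * s = of_int m" using N by (simp add: s_def Zs_def)
    then show ?thesis by (simp add: N_def algebra_simps)
  qed
  ultimately show ?thesis using that q by blast
qed

end

end

section \<open>Finitely many rays\<close>

lemma infinite_imp_three_less:
  fixes S :: "real set"
  assumes "infinite S"
  obtains a b c where "a \<in> S" "b \<in> S" "c \<in> S" "a < b" "b < c"
proof -
  obtain T where T: "finite T" "card T = 3" "T \<subseteq> S" using infinite_arbitrarily_large[OF assms] by blast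
  define xs where "xs = sorted_list_of_set T"
  have xs: "length xs = 3" "set xs = T" "sorted_wrt (<) xs" using T by (auto simp: xs_def)
  then show ?thesis
    using that[of "xs ! 0" "xs ! 1" "xs ! 2"] T(3) nth_mem[of 0 xs] nth_mem[of 1 xs] nth_mem[of 2 xs]
      sorted_wrt_nth_less[of "(<)" xs 0 1] sorted_wrt_nth_less[of "(<)" xs 1 2]
    by (simp add: subset_iff)
qed

lemma frac_eq_add_int: obtains j :: int where "frac (s :: real) = s + of_int j"
  by (rule that[of "- \<lfloor>s\<rfloor>"]) (simp add: frac_def)

context boettcher_unicritical
begin

section \<open>Angle sets along orbits and their finiteness\<close>

lemma cis_root_neq_1:
  assumes "\<not> int D dvd j" shows "cis (2 * pi * of_int j / D) \<noteq> 1"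
proof
  assume "cis (2 * pi * of_int j / D) = 1"
  then obtain n :: int where "2 * pi * of_int j / D = of_int (2 * n) * pi"
    unfolding cis_conv_exp exp_eq_1 by auto
  then have "pi * (2 * real_of_int j) = pi * (2 * (of_int n * real D))" using D_pos by (simp add: field_simps)
  then have "real_of_int j = of_int (n * int D)" by simp
  then have "j = n * int D" by (simp only: of_int_eq_iff)
  then show False using assms by simp
qed

lemma f_rotate: "f (cis (2 * pi * of_int j / D) * z) = f z"
  by (simp add: f_eq power_mult_distrib cis_root)

lemma angles_differ:
  assumes "lands a x" "lands b y" "x \<noteq> cis (2 * pi * of_int j / D) * y"
  shows "a \<noteq> b + of_int j / D"
  using lands_rotate[OF assms(2), of j] lands_unique assms(1,3) by blast

lemma rotated_angles_unlinked:
  assumes "lands a x" "lands b x" "lands s y" "lands s' y" "x \<noteq> cis (2 * pi * of_int j / D) * y"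
  shows "\<not> (a < s + of_int j / D \<and> s + of_int j / D < b \<and> b < s' + of_int j / D \<and> s' + of_int j / D < a + 1)"
  using rays_unlinked[OF assms(1,2) lands_rotate[OF assms(3)] lands_rotate[OF assms(4)] assms(5)] by blast

lemma rotation_unlinked_angles:
  assumes "x \<noteq> 0" shows "rotation_unlinked D {s. lands s x}"
proof -
  have ne: "x \<noteq> cis (2 * pi * of_int j / D) * x" if "\<not> int D dvd j" for j
    using cis_root_neq_1[OF that] assms by simp
  show ?thesis
  proof
    show "D \<ge> 2" by (rule D_ge_2)
    show "s + of_int j \<in> {s. lands s x}" if "s \<in> {s. lands s x}" for s j
      using that by (simp add: lands_add_int)
    show "a \<noteq> b + of_int j / D" if "\<not> int D dvd j" "a \<in> {s. lands s x}" "b \<in> {s. lands s x}" for a b j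
      by (rule angles_differ[OF _ _ ne[OF that(1)]]) (use that in simp_all)
    show "\<not> (a < s + of_int j / D \<and> s + of_int j / D < b \<and> b < s' + of_int j / D \<and> s' + of_int j / D < a + 1)"
      if "\<not> int D dvd j" "a \<in> {s. lands s x}" "b \<in> {s. lands s x}" "s \<in> {s. lands s x}" "s' \<in> {s. lands s x}"
      for a b s s' j
      by (rule rotated_angles_unlinked[OF _ _ _ _ ne[OF that(1)]]) (use that in simp_all)
  qed
qed

text \<open>If a rotation carries one orbit point to another, their images under \<open>f\<close>
  coincide, and injectivity of the orbit leaves only equal times. The rotation is then trivial
  because the point is not \<open>0\<close>.\<close>

lemma unlinked_angles_orbit:
  assumes nz: "\<And>n. (f ^^ n) x \<noteq> 0" and inj: "\<And>n m. (f ^^ n) x = (f ^^ m) x \<Longrightarrow> n = m"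
  shows "unlinked_angles D (\<lambda>n. {s. lands s ((f ^^ n) x)})"
proof -
  have ne: "(f ^^ n) x \<noteq> cis (2 * pi * of_int j / D) * (f ^^ m) x" if "n \<noteq> m \<or> \<not> int D dvd j" for n m j
  proof
    assume eq: "(f ^^ n) x = cis (2 * pi * of_int j / D) * (f ^^ m) x"
    then have "(f ^^ Suc n) x = (f ^^ Suc m) x" using f_rotate by simp
    then have "n = m" using inj by blast
    then show False using eq that cis_root_neq_1[of j] nz[of m] by simp
  qed
  show ?thesis
  proof
    let ?A = "\<lambda>n. {s. lands s ((f ^^ n) x)}"
    show "D \<ge> 2" by (rule D_ge_2)
    show "s + of_int j \<in> ?A n" if "s \<in> ?A n" for s j n
      using that by (simp add: lands_add_int)
    show "real D * s \<in> ?A (Suc n)" if "s \<in> ?A n" for s n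
      using that lands_f by simp
    show "a \<noteq> b + of_int j / D" if "n \<noteq> m \<or> \<not> int D dvd j" "a \<in> ?A n" "b \<in> ?A m" for a b j n m
      by (rule angles_differ[OF _ _ ne[OF that(1)]]) (use that in simp_all)
    show False if "n \<noteq> m \<or> \<not> int D dvd j" "a \<in> ?A n" "b \<in> ?A n" "s \<in> ?A m" "s' \<in> ?A m"
      "a < s + of_int j / D" "s + of_int j / D < b" "b < s' + of_int j / D" "s' + of_int j / D < a + 1"
      for a b s s' j n m
    proof -
      have "lands a ((f ^^ n) x)" "lands b ((f ^^ n) x)" "lands s ((f ^^ m) x)" "lands s' ((f ^^ m) x)"
        using that(2-5) by simp_all
      from rotated_angles_unlinked[OF this ne[OF that(1)]] show False using that(6-9) by blast
    qed
  qed
qed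

lemma finite_angles_wandering:
  assumes nz: "\<And>n. (f ^^ n) x \<noteq> 0" and inj: "\<And>n m. (f ^^ n) x = (f ^^ m) x \<Longrightarrow> n = m"
  shows "finite {s. 0 \<le> s \<and> s < 1 \<and> lands s x}"
proof (rule ccontr)
  interpret unlinked_angles D "\<lambda>n. {s. lands s ((f ^^ n) x)}" by (rule unlinked_angles_orbit[OF assms])
  assume "\<not> ?thesis"
  then obtain a b c where abc: "a \<in> {s. 0 \<le> s \<and> s < 1 \<and> lands s x}" "b \<in> {s. 0 \<le> s \<and> s < 1 \<and> lands s x}"
      "c \<in> {s. 0 \<le> s \<and> s < 1 \<and> lands s x}" "a < b" "b < c" by (rule infinite_imp_three_less)
  then show False using no_wandering_triangle[of a b c] by simp
qed

text \<open>If any ray lands at \<open>z\<close>, it supplies a basin point in the disc of the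
  inverse branch, and so a periodic angle \<open>s\<close>. The angles between \<open>s\<close> and
  \<open>s + 1\<close> then differ from \<open>s\<close> by multiples of
  \<open>1 / (N - 1)\<close>.\<close>

lemma finite_angles_repelling:
  assumes p: "p \<ge> 1" "(f ^^ p) z = z" and rep: "norm (deriv (f ^^ p) z) > 1" and nz: "\<And>n. (f ^^ n) z \<noteq> 0"
  shows "finite {s. 0 \<le> s \<and> s < 1 \<and> lands s z}"
proof (cases "\<exists>b. lands b z")
  case True
  then obtain b where b: "lands b z" by blast
  have zK: "z \<in> K" by (rule lands_in_K[OF b])
  obtain r h \<mu> where r: "r > 0" and \<mu>: "\<mu> > 1" and h: "h holomorphic_on ball z r"
    "\<And>w. w \<in> ball z r \<Longrightarrow> h w \<in> ball z r" "\<And>w. w \<in> ball z r \<Longrightarrow> (f ^^ p) (h w) = w"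
    "\<And>w. w \<in> ball z r \<Longrightarrow> norm (h w - z) \<le> norm (w - z) / \<mu>"
    by (rule repelling_inverse_branch[OF holomorphic_iter p(2) rep]) blast
  have "eventually (\<lambda>t. dist (Psi (Complex t (2 * pi * b))) z < r) (at_right 0)"
    using b r unfolding lands_def by (rule tendstoD)
  then obtain t0 where t0: "t0 > 0" "\<And>t. 0 < t \<Longrightarrow> t < t0 \<Longrightarrow> dist (Psi (Complex t (2 * pi * b))) z < r"
    unfolding eventually_at_right_field by blast
  define P where "P = Psi (Complex (t0 / 2) (2 * pi * b))"
  have P: "P \<in> ball z r" "P \<notin> K"
    using t0(2)[of "t0 / 2"] t0(1) Psi_notin_K by (auto simp: P_def dist_commute)
  obtain s q j where sq: "q \<ge> 1" "lands s z" "real D ^ (p * q) * s = s + of_int j"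
    by (rule periodic_ray_lands[OF zK \<mu> p(1) h P]) blast
  define N where "N = real D ^ (p * q)"
  have N: "N \<ge> 2"
  proof -
    have "real D ^ 1 \<le> N" unfolding N_def using D_pos p sq by (intro power_increasing) auto
    then show ?thesis using D_pos(2) by simp
  qed
  have period: "(f ^^ (p * q)) z = z"
  proof -
    have "((f ^^ p) ^^ q) z = z" by (induction q) (use p(2) in auto)
    then show ?thesis by (simp add: funpow_mult)
  qed
  have int: "(N - 1) * (b' - s) \<in> \<int>" if b': "lands b' z" "s < b'" "b' < s + 1" for b'
    unfolding N_def
  proof (rule angles_periodic[where A = "\<lambda>n. {s. lands s ((f ^^ n) z)}" and j = j])
    show "rotation_unlinked D {s. lands s ((f ^^ n) z)}" for n
      by (rule rotation_unlinked_angles[OF nz])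
    show "a \<in> {s. lands s ((f ^^ n) z)} \<Longrightarrow> real D * a \<in> {s. lands s ((f ^^ Suc n) z)}" for n a
      using lands_f by simp
  qed (use period sq b' in auto)
  have sub: "{b'. lands b' z \<and> s \<le> b' \<and> b' < s + 1} \<subseteq> (\<lambda>k. s + of_int k / (N - 1)) ` {0..\<lceil>N\<rceil>}"
  proof
    fix b' assume "b' \<in> {b'. lands b' z \<and> s \<le> b' \<and> b' < s + 1}"
    then have b': "lands b' z" "s \<le> b'" "b' < s + 1" by auto
    then have "(N - 1) * (b' - s) \<in> \<int>" using int by (cases "s = b'") auto
    then obtain k :: int where k: "(N - 1) * (b' - s) = of_int k" by (auto elim: Ints_cases)
    have "0 \<le> (N - 1) * (b' - s)" using b' N by simp
    moreover have "(N - 1) * (b' - s) \<le> (N - 1) * 1" using b' N by (intro mult_left_mono) auto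
    ultimately have "k \<in> {0..\<lceil>N\<rceil>}" unfolding k using le_of_int_ceiling[of N] by simp linarith
    moreover have "b' = s + of_int k / (N - 1)" using N k[symmetric] by simp
    ultimately show "b' \<in> (\<lambda>k. s + of_int k / (N - 1)) ` {0..\<lceil>N\<rceil>}" by blast
  qed
  have "{t. 0 \<le> t \<and> t < 1 \<and> lands t z} \<subseteq> frac ` {b'. lands b' z \<and> s \<le> b' \<and> b' < s + 1}"
  proof
    fix t assume "t \<in> {t. 0 \<le> t \<and> t < 1 \<and> lands t z}"
    then have t: "0 \<le> t" "t < 1" "lands t z" by auto
    define b' where "b' = t + of_int (- \<lfloor>t - s\<rfloor>)"
    have "lands b' z" unfolding b'_def lands_add_int by (rule t(3))
    moreover have "s \<le> b'" "b' < s + 1" unfolding b'_def by linarith+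
    moreover have "frac b' = t" using t by (simp add: b'_def frac_unique_iff)
    ultimately show "t \<in> frac ` {b'. lands b' z \<and> s \<le> b' \<and> b' < s + 1}" by blast
  qed
  then show ?thesis using finite_subset[OF sub] by (meson finite_atLeastAtMost_int finite_imageI finite_subset)
qed simp

text \<open>Multiplication by \<open>real D ^ m\<close> modulo \<open>1\<close> sends angles at
  \<open>x\<close> to angles at the iterate and is finite-to-one.\<close>

lemma finite_angles_preimage:
  assumes "finite {s. 0 \<le> s \<and> s < 1 \<and> lands s ((f ^^ m) x)}"
  shows "finite {s. 0 \<le> s \<and> s < 1 \<and> lands s x}"
proof -
  have lands_iter: "lands (real D ^ n * s) ((f ^^ n) x)" if "lands s x" for s n
  proof (induction n)
    case (Suc n)
    from lands_f[OF this] show ?case by (simp add: mult.assoc)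
  qed (use that in simp)
  define N where "N = real D ^ m"
  have N: "N > 0" using D_pos by (simp add: N_def)
  define S where "S = (\<lambda>(t, k). (t + of_int k) / N) ` ({s. 0 \<le> s \<and> s < 1 \<and> lands s ((f ^^ m) x)} \<times> {0..\<lceil>N\<rceil>})"
  have "{s. 0 \<le> s \<and> s < 1 \<and> lands s x} \<subseteq> S"
  proof
    fix s assume "s \<in> {s. 0 \<le> s \<and> s < 1 \<and> lands s x}"
    then have s: "0 \<le> s" "s < 1" "lands s x" by auto
    have 1: "lands (frac (N * s)) ((f ^^ m) x)"
      using lands_iter[OF s(3), of m] lands_add_int[of "N * s" "- \<lfloor>N * s\<rfloor>"] by (simp add: frac_def N_def)
    have "N * s \<le> N * 1" using N s by (intro mult_left_mono) auto
    then have "N * s < of_int \<lceil>N\<rceil> + 1" using le_of_int_ceiling[of N] by linarith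
    then have 2: "\<lfloor>N * s\<rfloor> \<in> {0..\<lceil>N\<rceil>}" using N s by (simp add: floor_le_iff)
    have "s = (frac (N * s) + of_int \<lfloor>N * s\<rfloor>) / N" using N by (simp add: frac_def)
    then show "s \<in> S" unfolding S_def using 1 2 frac_ge_0 frac_lt_1 by force
  qed
  moreover have "finite S" unfolding S_def using assms by simp
  ultimately show ?thesis by (rule finite_subset)
qed

lemma deriv_iter_add:
  "deriv (f ^^ (m + n)) z = deriv (f ^^ m) ((f ^^ n) z) * deriv (f ^^ n) z"
proof -
  have "(f ^^ k) field_differentiable at w" for k w
    using holomorphic_iter[of k UNIV] by (simp add: holomorphic_on_def)
  then show ?thesis unfolding funpow_add by (intro deriv_chain)
qed

lemma finite_angles_hyperbolic:
  assumes "hyperbolic_set f \<Lambda>" "x \<in> \<Lambda>"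
  shows "finite {s. 0 \<le> s \<and> s < 1 \<and> lands s x}"
proof -
  from assms(1) obtain k0 \<eta> where \<Lambda>: "f ` \<Lambda> \<subseteq> \<Lambda>" and \<eta>: "\<eta> > 1"
      "\<And>x k. x \<in> \<Lambda> \<Longrightarrow> k > k0 \<Longrightarrow> norm (deriv (f ^^ k) x) > \<eta>"
    unfolding hyperbolic_set_def by blast
  have iter: "(f ^^ n) w \<in> \<Lambda>" if "w \<in> \<Lambda>" for n w by (induction n) (use that \<Lambda> in auto)
  have nz0: "w \<noteq> 0" if w: "w \<in> \<Lambda>" for w
  proof
    assume "w = 0"
    have "(f has_field_derivative of_nat D * w ^ (D - 1)) (at w)"
      unfolding f_def unicritical_def by (auto intro!: derivative_eq_intros)
    then have "deriv (f ^^ 1) w = 0" using D_ge_2 \<open>w = 0\<close> by (simp add: DERIV_imp_deriv)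
    then have "deriv (f ^^ (Suc k0 + 1)) w = 0" by (simp only: deriv_iter_add mult_zero_right)
    then show False using \<eta>(2)[OF w, of "Suc k0 + 1"] \<eta>(1) by simp
  qed
  have nz: "(f ^^ n) w \<noteq> 0" if "w \<in> \<Lambda>" for n w using nz0 iter that by blast
  show ?thesis
  proof (cases "\<forall>n m. (f ^^ n) x = (f ^^ m) x \<longrightarrow> n = m")
    case True
    then show ?thesis using finite_angles_wandering nz assms(2) by blast
  next
    case False
    then obtain m n where mn: "m < n" "(f ^^ n) x = (f ^^ m) x" by (metis linorder_neqE_nat)
    define z where "z = (f ^^ m) x"
    define p where "p = n - m"
    have z: "z \<in> \<Lambda>" using iter assms(2) by (simp add: z_def)
    have p: "p \<ge> 1" using mn by (simp add: p_def)
    have "(f ^^ p) z = (f ^^ (p + m)) x" by (simp add: z_def funpow_add)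
    also have "\<dots> = z" using mn by (simp add: p_def z_def)
    finally have fp: "(f ^^ p) z = z" .
    have fpk: "(f ^^ (k * p)) z = z" for k by (induction k) (simp_all add: fp funpow_add)
    have deriv_pow: "deriv (f ^^ (k * p)) z = deriv (f ^^ p) z ^ k" for k
    proof (induction k)
      case 0
      show ?case by (simp add: id_def[symmetric])
    next
      case (Suc k)
      have "deriv (f ^^ (Suc k * p)) z = deriv (f ^^ p) ((f ^^ (k * p)) z) * deriv (f ^^ (k * p)) z"
        unfolding mult_Suc by (rule deriv_iter_add)
      then show ?case by (simp add: fpk Suc)
    qed
    \<comment> \<open>Powers of the multiplier are derivatives of high iterates; the exponent
      \<open>Suc k0\<close> makes the iterate exceed \<open>k0\<close>, where hyperbolicity
      applies.\<close>
    have "norm (deriv (f ^^ p) z) > 1"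
    proof (rule ccontr)
      assume "\<not> ?thesis"
      then have "norm (deriv (f ^^ p) z) ^ Suc k0 \<le> 1" by (intro power_le_one) auto
      moreover have "Suc k0 * p > k0" using p by (cases p) auto
      ultimately show False
        using \<eta>(2)[OF z, of "Suc k0 * p"] \<eta>(1) unfolding deriv_pow norm_power by linarith
    qed
    then have "finite {s. 0 \<le> s \<and> s < 1 \<and> lands s z}" by (rule finite_angles_repelling[OF p fp _ nz[OF z]])
    then show ?thesis unfolding z_def by (rule finite_angles_preimage)
  qed
qed

lemma finite_rays_hyperbolic:
  assumes "hyperbolic_set f \<Lambda>" "x \<in> \<Lambda>"
  shows "finite {R \<in> dynamic_rays f B. lands_at R x}"
proof (rule finite_subset)
  show "finite ((\<lambda>s. dynamic_ray f B s ` {0<..}) ` {s. 0 \<le> s \<and> s < 1 \<and> lands s x})"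
    using finite_angles_hyperbolic[OF assms] by simp
  show "{R \<in> dynamic_rays f B. lands_at R x} \<subseteq> (\<lambda>s. dynamic_ray f B s ` {0<..}) ` {s. 0 \<le> s \<and> s < 1 \<and> lands s x}"
  proof
    fix R assume "R \<in> {R \<in> dynamic_rays f B. lands_at R x}"
    then obtain s where s: "R = dynamic_ray f B s ` {0<..}" "lands_at R x" by (auto simp: dynamic_rays_def)
    obtain j :: int where j: "frac s = s + of_int j" by (rule frac_eq_add_int)
    have "dynamic_ray f B (frac s) = dynamic_ray f B s"
      unfolding j by (rule ext) (simp only: dynamic_ray_eq Psi_add_2pi_int)
    then have "R = dynamic_ray f B (frac s) ` {0<..}" using s(1) by simp
    moreover have "lands (frac s) x"
      unfolding j lands_add_int using s by (intro lands_at_imp_lands) simp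
    then have "frac s \<in> {s. 0 \<le> s \<and> s < 1 \<and> lands s x}" using frac_ge_0 frac_lt_1 by simp
    ultimately show "R \<in> (\<lambda>s. dynamic_ray f B s ` {0<..}) ` {s. 0 \<le> s \<and> s < 1 \<and> lands s x}"
      by (rule image_eqI)
  qed
qed

end

theorem proposition2p11:
  fixes D :: nat and c :: complex and f B :: "complex \<Rightarrow> complex" and \<Lambda> :: "complex set"
  defines "f \<equiv> unicritical D c"
  assumes "D \<ge> 2"
    and "connected (julia f)"
    and "boettcher_map f D B"
    and "hyperbolic_set f \<Lambda>"
    and "accessible f B 0 \<or> (\<forall>x\<in>\<Lambda>. combinatorially_separated f B x 0)"
  shows "\<forall>x\<in>\<Lambda>. finite {R \<in> dynamic_rays f B. lands_at R x}"
proof -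
  interpret boettcher_unicritical D c f B
  proof
    show "f = unicritical D c" by (simp only: f_def)
  qed (fact assms(2), fact assms(4))
  show ?thesis using finite_rays_hyperbolic assms(5) by blast
qed

end
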